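(* Let $n,m$ be positive integers, let $W$ be a symmetric $BGW(n+1,n,n-1)$ with zero diagonal entries over the cyclic group $C_m=\langle U\rangle$, and let $\{A_{l,0},A_{l,1}\mid l\in\mathbb{Z}_m\}$ be the association scheme constructed from $W$ in the context. Put $F_{\alpha,i}=\sum_{\gamma\in\mathbb{Z}_m}\chi_\alpha(\gamma)A_{\gamma,i}$ for $\alpha\in\mathbb{Z}_m$, $i\in\{0,1\}$, and define $$E_0=\tfrac{1}{(n+1)m}J_{(n+1)m},\qquad E_1=\tfrac{1}{(n+1)m}(nF_{0,0}-F_{0,1}),$$ $$E_2=\tfrac1{2m}\Big(F_{m/2,0}+\tfrac1{\sqrt n}F_{m/2,1}\Big),\qquad E_3=\tfrac1{2m}\Big(F_{m/2,0}-\tfrac1{\sqrt n}F_{m/2,1}\Big)\quad(\text{only for } m \text{ even}),$$ $$E_{1,1}^{(\alpha)}=\tfrac1mF_{\alpha,0},\quad E_{2,2}^{(\alpha)}=\tfrac1mF_{-\alpha,0},\quad E_{1,2}^{(\alpha)}=\tfrac1{m\sqrt n}F_{\alpha,1},\quad E_{2,1}^{(\alpha)}=\tfrac1{m\sqrt n}F_{-\alpha,1}.$$ (1) If $m$ is even, then the matrices $E_0,E_1,E_2,E_3,E_{1,1}^{(\alpha)},E_{1,2}^{(\alpha)},E_{2,1}^{(\alpha)},E_{2,2}^{(\alpha)}$, $\alpha\in\{1,\dots,m/2-1\}$, provide the Wedderburn decomposition of the adjacency algebra of the association scheme. (2) If $m$ is odd, then the matrices $E_0,E_1,E_{1,1}^{(\alpha)},E_{1,2}^{(\alpha)},E_{2,1}^{(\alpha)},E_{2,2}^{(\alpha)}$,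 $\alpha\in\{1,\dots,(m-1)/2\}$, provide the Wedderburn decomposition of the adjacency algebra of the association scheme.
   Context: $I_r$, $J_r$: identity and all-ones matrices of order $r$. The adjacency algebra of an association scheme is the complex span of its adjacency matrices. A family of matrices $E_i$ (one-dimensional components) and $E_{j,k}^{(\alpha)}$, $j,k\in\{1,2\}$ (two-dimensional components), provides the Wedderburn decomposition of the adjacency algebra $\mathcal{A}$ if it is a basis of $\mathcal{A}$ satisfying $E_iE_{i'}=\delta_{i,i'}E_i$, $E_iE_{j,k}^{(\alpha)}=E_{j,k}^{(\alpha)}E_i=0$, $E_{j,k}^{(\alpha)}E_{j',k'}^{(\beta)}=\delta_{\alpha,\beta}\delta_{k,j'}E_{j,k'}^{(\alpha)}$, and $E_i^*=E_i$, $(E_{j,k}^{(\alpha)})^*=E_{k,j}^{(\alpha)}$ ($*$ = conjugate transpose). For a finite multiplicative group $G$, a $BGW(v,k,\lambda)$ over $G$ is a $v\times v$ matrix $W=(w_{ij})$ with entries in $G\cup\{0\}$ such that (i) every row contains exactly $k$ nonzero entries, and (ii) for any distinct $i,h$, every element of $G$ occurs exactly $\lambda/|G|$ times in the multiset $\{w_{ij}w_{hj}^{-1}\mid 1\le j\le v,\ w_{ij}\ne0,\ w_{hj}\neq0\}$. It is symmetric if $w_{ij}=w_{ji}$ for all $i,j$. $U$ is the circulant $m\times m$ matrix with first row $(0,1,0,\dots,0)$ ($U=(1)$ if $m=1$), $C_m=\langle U\rangle$, so each nonzero $w_{ij}$ is a power of $U$. $R$ is the $m\times m$ back diagonal matrix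 (ones on the anti-diagonal). For $l\in\mathbb{Z}_m$, $N_l$ is the $(n+1)m\times(n+1)m$ matrix with $m\times m$ blocks $[N_l]_{ij}=J_m$ if $i=j$ and $[N_l]_{ij}=w_{ij}U^lR$ if $i\ne j$. $A_{l,0}=I_{n+1}\otimes U^l$, $A_{l,1}=N_l-I_{n+1}\otimes J_m$. Characters of $\mathbb{Z}_m$: $\chi_\beta(\alpha)=w^{\alpha\beta}$ with $w=e^{2\pi\sqrt{-1}/m}$. *)

theory Defs
  imports
    "HOL-Library.Multiset"
    "HOL-Algebra.Coset"
    "Jordan_Normal_Form.Schur_Decomposition"
    "Jordan_Normal_Form.VS_Connect"
begin

hide_const (open) Multiset.mult Polynomial.order

text \<open>The zero entry of a matrix over \<open>G \<union> {0}\<close> is \<open>None\<close>; a nonzero entry \<open>g\<close> is \<open>Some g\<close>.\<close>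

definition is_BGW ::
  "('g, 'b) monoid_scheme \<Rightarrow> nat \<Rightarrow> nat \<Rightarrow> nat \<Rightarrow> 'g option mat \<Rightarrow> bool" where
  "is_BGW G v k lam W \<longleftrightarrow>
     group G \<and> finite (carrier G) \<and>
     W \<in> carrier_mat v v \<and>
     (\<forall>i<v. \<forall>j<v. W $$ (i,j) \<in> insert None (Some ` carrier G)) \<and>
     (\<forall>i<v. card {j. j < v \<and> W $$ (i,j) \<noteq> None} = k) \<and>
     (\<forall>i<v. \<forall>h<v. i \<noteq> h \<longrightarrow>
        (\<forall>g\<in>carrier G.
           real (count
             {# the (W $$ (i,j)) \<otimes>\<^bsub>G\<^esub> inv\<^bsub>G\<^esub> the (W $$ (h,j)).
                j \<in># mset_set {j. j < v \<and> W $$ (i,j) \<noteq> None \<and> W $$ (h,j) \<noteq> None} #} g)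
           = real lam / real (order G)))"

definition allones_mat :: "nat \<Rightarrow> complex mat" where
  "allones_mat r = mat r r (\<lambda>_. 1)"

definition circ_mat :: "nat \<Rightarrow> complex mat" where
  "circ_mat m = mat m m (\<lambda>(i,j). if j = (i + 1) mod m then 1 else 0)"

definition backdiag_mat :: "nat \<Rightarrow> complex mat" where
  "backdiag_mat m = mat m m (\<lambda>(i,j). if i + j + 1 = m then 1 else 0)"

definition circ_group :: "nat \<Rightarrow> complex mat monoid" where
  "circ_group m = \<lparr> carrier = range (\<lambda>k. circ_mat m ^\<^sub>m k), mult = (*), one = 1\<^sub>m m \<rparr>"

lemma circ_mat_pow:
  assumes "m > 0"
  shows "circ_mat m ^\<^sub>m k = mat m m (\<lambda>(i,j). if j = (i + k) mod m then 1 else 0)"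
proof (induction k)
  case 0
  show ?case by (rule eq_matI) (auto simp: circ_mat_def)
next
  case (Suc k)
  show ?case
  proof (rule eq_matI)
    fix i j assume "i < dim_row (mat m m (\<lambda>(i,j). if j = (i + Suc k) mod m then 1 else 0 :: complex))"
      and "j < dim_col (mat m m (\<lambda>(i,j). if j = (i + Suc k) mod m then 1 else 0 :: complex))"
    then have ij: "i < m" "j < m" by auto
    have "(circ_mat m ^\<^sub>m Suc k) $$ (i,j)
        = (\<Sum>r\<in>{0..<m}. (if r = (i + k) mod m then 1 else 0) * (if j = (r + 1) mod m then 1 else 0))"
    proof -
      have "(circ_mat m ^\<^sub>m Suc k) $$ (i,j) = (\<Sum>r\<in>{0..<m}. (circ_mat m ^\<^sub>m k) $$ (i,r) * circ_mat m $$ (r,j))"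
        using ij by (simp add: circ_mat_def scalar_prod_def)
      also have "\<dots> = (\<Sum>r\<in>{0..<m}. (if r = (i + k) mod m then 1 else 0) * (if j = (r + 1) mod m then 1 else 0))"
        unfolding Suc using ij by (intro sum.cong) (auto simp: circ_mat_def)
      finally show ?thesis .
    qed
    also have "\<dots> = (\<Sum>r\<in>{0..<m}. if r = (i + k) mod m then (if j = (r + 1) mod m then 1 else 0) else 0)"
      by (rule sum.cong) auto
    also have "\<dots> = (if j = ((i + k) mod m + 1) mod m then 1 else 0)"
      using assms by (simp add: sum.delta)
    finally show "(circ_mat m ^\<^sub>m Suc k) $$ (i,j)
        = mat m m (\<lambda>(i,j). if j = (i + Suc k) mod m then 1 else 0) $$ (i,j)"
      using ij by (simp add: mod_simps)
  qed (simp_all add: Suc circ_mat_def)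
qed

lemma circ_group_finite_group:
  assumes "m > 0"
  shows "group (circ_group m)" "finite (carrier (circ_group m))" "order (circ_group m) = m"
proof -
  have U: "circ_mat m \<in> carrier_mat m m" by (simp add: circ_mat_def)
  have P: "circ_mat m ^\<^sub>m k \<in> carrier_mat m m" for k using U by simp
  have add: "circ_mat m ^\<^sub>m a * circ_mat m ^\<^sub>m b = circ_mat m ^\<^sub>m (a + b)" for a b
  proof (induction b)
    case (Suc b)
    then show ?case by (simp add: assoc_mult_mat[OF P P U, symmetric])
  qed (use P U in auto)
  have per: "circ_mat m ^\<^sub>m k = circ_mat m ^\<^sub>m (k mod m)" for k
    by (simp add: circ_mat_pow[OF assms] mod_simps)
  have one: "circ_mat m ^\<^sub>m 0 = 1\<^sub>m m" using U by auto
  show "group (circ_group m)"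
  proof (rule groupI)
    fix x assume "x \<in> carrier (circ_group m)"
    then obtain k where k: "x = circ_mat m ^\<^sub>m k" by (auto simp: circ_group_def)
    have "circ_mat m ^\<^sub>m (k * (m - 1)) * x = 1\<^sub>m m"
    proof -
      have "k * (m - 1) + k = k * m" using assms by (cases m) auto
      then show ?thesis using per[of "k * m"] one by (simp add: k add)
    qed
    then show "\<exists>y\<in>carrier (circ_group m). y \<otimes>\<^bsub>circ_group m\<^esub> x = \<one>\<^bsub>circ_group m\<^esub>"
      by (auto simp: circ_group_def)
    show "\<one>\<^bsub>circ_group m\<^esub> \<otimes>\<^bsub>circ_group m\<^esub> x = x"
      using left_mult_one_mat[OF P] by (simp add: circ_group_def k)
  qed (auto simp: circ_group_def add add.assoc one[symmetric] simp del: pow_mat.simps)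
  have ran: "carrier (circ_group m) = (\<lambda>k. circ_mat m ^\<^sub>m k) ` {..<m}"
    unfolding circ_group_def using per assms by (auto intro!: image_eqI[where x = "_ mod m"])
  then show "finite (carrier (circ_group m))" by simp
  have "inj_on (\<lambda>k. circ_mat m ^\<^sub>m k) {..<m}"
  proof (rule inj_onI)
    fix a b assume ab: "a \<in> {..<m}" "b \<in> {..<m}" and eq: "circ_mat m ^\<^sub>m a = circ_mat m ^\<^sub>m b"
    then have "(circ_mat m ^\<^sub>m a) $$ (0,a) = (circ_mat m ^\<^sub>m b) $$ (0,a)" by simp
    then show "a = b" using ab assms by (simp add: circ_mat_pow split: if_splits)
  qed
  then show "order (circ_group m) = m" by (simp add: Coset.order_def ran card_image)
qed

definition kron_mat :: "complex mat \<Rightarrow> complex mat \<Rightarrow> complex mat" where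
  "kron_mat A B = mat (dim_row A * dim_row B) (dim_col A * dim_col B)
     (\<lambda>(r,c). A $$ (r div dim_row B, c div dim_col B) * B $$ (r mod dim_row B, c mod dim_col B))"

text \<open>The \<open>k m \<times> k m\<close> matrix whose \<open>(i,j)\<close> block, \<open>i, j < k\<close>, is the \<open>m \<times> m\<close> matrix \<open>B i j\<close>.\<close>

definition block_mat :: "nat \<Rightarrow> nat \<Rightarrow> (nat \<Rightarrow> nat \<Rightarrow> complex mat) \<Rightarrow> complex mat" where
  "block_mat k m B = mat (k * m) (k * m)
     (\<lambda>(r,c). B (r div m) (c div m) $$ (r mod m, c mod m))"

definition entry_mat :: "nat \<Rightarrow> complex mat option \<Rightarrow> complex mat" where
  "entry_mat m x = (case x of None \<Rightarrow> 0\<^sub>m m m | Some g \<Rightarrow> g)"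

definition N_mat :: "nat \<Rightarrow> nat \<Rightarrow> complex mat option mat \<Rightarrow> nat \<Rightarrow> complex mat" where
  "N_mat n m W l = block_mat (n + 1) m
     (\<lambda>i j. if i = j then allones_mat m
            else entry_mat m (W $$ (i,j)) * (circ_mat m ^\<^sub>m l) * backdiag_mat m)"

text \<open>Elements of \<open>\<int>\<^sub>m\<close> are represented by integers: by \<open>l < m\<close> where they index the matrices
  \<open>A\<close>, and by arbitrary representatives as arguments of \<open>chi\<close> and \<open>F_mat\<close>, which are
  \<open>m\<close>-periodic in them.\<close>

definition A_mat :: "nat \<Rightarrow> nat \<Rightarrow> complex mat option mat \<Rightarrow> nat \<Rightarrow> nat \<Rightarrow> complex mat" where
  "A_mat n m W l i =
     (if i = 0 then kron_mat (1\<^sub>m (n + 1)) (circ_mat m ^\<^sub>m l)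
      else N_mat n m W l - kron_mat (1\<^sub>m (n + 1)) (allones_mat m))"

definition chi :: "nat \<Rightarrow> int \<Rightarrow> int \<Rightarrow> complex" where
  "chi m \<beta> \<alpha> = exp (2 * of_real pi * \<i> / of_nat m) powi (\<alpha> * \<beta>)"

definition F_mat :: "nat \<Rightarrow> nat \<Rightarrow> complex mat option mat \<Rightarrow> int \<Rightarrow> nat \<Rightarrow> complex mat" where
  "F_mat n m W \<alpha> i =
     finsum (module_mat TYPE(complex) ((n + 1) * m) ((n + 1) * m))
       (\<lambda>\<gamma>. chi m \<alpha> (int \<gamma>) \<cdot>\<^sub>m A_mat n m W \<gamma> i) {..<m}"

definition adjacency_algebra :: "nat \<Rightarrow> complex mat set \<Rightarrow> complex mat set" where
  "adjacency_algebra N S = LinearCombinations.module.span class_ring (module_mat TYPE(complex) N N) S"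

text \<open>\<open>E\<close> and \<open>D\<close> are the families of one- and two-dimensional components, indexed by \<open>I\<close> and
  \<open>P \<times> {1,2} \<times> {1,2}\<close>. Injectivity of the combined family makes the first two conditions say that
  the family, and not merely its set of values, is a basis of \<open>\<A>\<close>.\<close>

definition wedderburn_decomposition ::
  "nat \<Rightarrow> complex mat set \<Rightarrow> 'i set \<Rightarrow> ('i \<Rightarrow> complex mat) \<Rightarrow>
   'p set \<Rightarrow> ('p \<Rightarrow> nat \<Rightarrow> nat \<Rightarrow> complex mat) \<Rightarrow> bool" where
  "wedderburn_decomposition N \<A> I E P D \<longleftrightarrow>
     (let fam = case_sum E (\<lambda>(\<alpha>,j,k). D \<alpha> j k); idx = I <+> P \<times> {1,2} \<times> {1,2} in
        inj_on fam idx \<and>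
        vectorspace.basis class_ring ((module_mat TYPE(complex) N N)\<lparr>carrier := \<A>\<rparr>) (fam ` idx)) \<and>
     (\<forall>i\<in>I. \<forall>i'\<in>I. E i * E i' = (if i = i' then E i else 0\<^sub>m N N)) \<and>
     (\<forall>i\<in>I. \<forall>\<alpha>\<in>P. \<forall>j\<in>{1,2}. \<forall>k\<in>{1,2}.
        E i * D \<alpha> j k = 0\<^sub>m N N \<and> D \<alpha> j k * E i = 0\<^sub>m N N) \<and>
     (\<forall>\<alpha>\<in>P. \<forall>\<beta>\<in>P. \<forall>j\<in>{1,2}. \<forall>k\<in>{1,2}. \<forall>j'\<in>{1,2}. \<forall>k'\<in>{1,2}.
        D \<alpha> j k * D \<beta> j' k' = (if \<alpha> = \<beta> \<and> k = j' then D \<alpha> j k' else 0\<^sub>m N N)) \<and>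
     (\<forall>i\<in>I. mat_adjoint (E i) = E i) \<and>
     (\<forall>\<alpha>\<in>P. \<forall>j\<in>{1,2}. \<forall>k\<in>{1,2}. mat_adjoint (D \<alpha> j k) = D \<alpha> k j)"

text \<open>The components for \<open>i = 2, 3\<close> are meaningful for even \<open>m\<close> only.\<close>

definition E_one :: "nat \<Rightarrow> nat \<Rightarrow> complex mat option mat \<Rightarrow> nat \<Rightarrow> complex mat" where
  "E_one n m W i =
     (if i = 0 then (1 / of_nat ((n + 1) * m)) \<cdot>\<^sub>m allones_mat ((n + 1) * m)
      else if i = 1 then (1 / of_nat ((n + 1) * m)) \<cdot>\<^sub>m (of_nat n \<cdot>\<^sub>m F_mat n m W 0 0 - F_mat n m W 0 1)
      else if i = 2 then (1 / of_nat (2 * m)) \<cdot>\<^sub>m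
        (F_mat n m W (int m div 2) 0 + (1 / of_real (sqrt (real n))) \<cdot>\<^sub>m F_mat n m W (int m div 2) 1)
      else (1 / of_nat (2 * m)) \<cdot>\<^sub>m
        (F_mat n m W (int m div 2) 0 - (1 / of_real (sqrt (real n))) \<cdot>\<^sub>m F_mat n m W (int m div 2) 1))"

definition E_two ::
  "nat \<Rightarrow> nat \<Rightarrow> complex mat option mat \<Rightarrow> int \<Rightarrow> nat \<Rightarrow> nat \<Rightarrow> complex mat" where
  "E_two n m W \<alpha> j k =
     (if j = 1 \<and> k = 1 then (1 / of_nat m) \<cdot>\<^sub>m F_mat n m W \<alpha> 0
      else if j = 2 \<and> k = 2 then (1 / of_nat m) \<cdot>\<^sub>m F_mat n m W (- \<alpha>) 0
      else if j = 1 \<and> k = 2 then (1 / (of_nat m * of_real (sqrt (real n)))) \<cdot>\<^sub>m F_mat n m W \<alpha> 1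
      else (1 / (of_nat m * of_real (sqrt (real n)))) \<cdot>\<^sub>m F_mat n m W (- \<alpha>) 1)"

end

theory Submission
  imports Defs
begin

text \<open>
  Write \<open>w\<^sub>i\<^sub>j = U\<^sup>e\<^sup>(\<^sup>i\<^sup>,\<^sup>j\<^sup>)\<close> for the off-diagonal entries of \<open>W\<close>.  Counted by in-block
  positions \<open>x\<close>, \<open>y\<close>, the blocks of \<open>F\<^sub>\<alpha>\<^sub>,\<^sub>0\<close> and \<open>F\<^sub>\<alpha>\<^sub>,\<^sub>1\<close> have the entries
  \<open>\<chi>\<^sub>\<alpha>(y - x)\<close> (on the diagonal) and \<open>\<chi>\<^sub>\<alpha>(-x - y - 1 - e(i,j))\<close> (off the diagonal), all other
  blocks being zero.  Multiplying two such matrices means summing over an in-block position and over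
  a block.  The first sum is a character sum over \<open>\<int>\<^sub>m\<close> and gives orthogonality in \<open>\<alpha>\<close>; because the
  back diagonal matrix inverts \<open>U\<close>, a factor \<open>F\<^sub>\<alpha>\<^sub>,\<^sub>1\<close> on the left pairs \<open>\<alpha>\<close> with \<open>-\<alpha>\<close> instead of
  with \<open>\<alpha>\<close>.  The second sum is nontrivial only in \<open>F\<^sub>\<alpha>\<^sub>,\<^sub>1 F\<^sub>-\<^sub>\<alpha>\<^sub>,\<^sub>1\<close>, where it runs over
  \<open>\<chi>\<^sub>\<alpha>(e(k,j) - e(i,k))\<close>; here the defining property of a BGW matrix says that the
  exponents are equidistributed modulo \<open>m\<close>, so the sum vanishes unless \<open>\<alpha> = 0\<close>.  Hence
  \<open>F\<^sub>\<alpha>\<^sub>,\<^sub>1 F\<^sub>-\<^sub>\<alpha>\<^sub>,\<^sub>1 = m n F\<^sub>\<alpha>\<^sub>,\<^sub>0\<close> for \<open>\<alpha> \<noteq> 0\<close>, with an additional summand \<open>m (n - 1) F\<^sub>0\<^sub>,\<^sub>1\<close> for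
  \<open>\<alpha> = 0\<close>.

  All these products are one formula, \<open>X_mult\<close>, for the matrices \<open>p F\<^sub>\<alpha>\<^sub>,\<^sub>0 + q F\<^sub>\<alpha>\<^sub>,\<^sub>1\<close>, and every component
  of the decomposition is such a matrix.  The classes \<open>\<alpha> = 0\<close> and \<open>\<alpha> = m/2\<close>, which equal their
  negatives, carry two orthogonal idempotents each; a pair \<open>{\<alpha>, -\<alpha>}\<close> with \<open>\<alpha> \<noteq> -\<alpha>\<close> carries a
  \<open>2 \<times> 2\<close> matrix algebra.

  That the components form a basis needs little more: nonzero matrices with these multiplication
  rules are automatically distinct and linearly independent (\<open>wedderburn_decompositionI\<close>), they lie in
  the algebra because the \<open>F\<^sub>\<alpha>\<^sub>,\<^sub>i\<close> do, and they span it because Fourier inversion recovers the adjacency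
  matrices from the \<open>F\<^sub>\<alpha>\<^sub>,\<^sub>i\<close> (\<open>A_fourier_inversion\<close>).
\<close>

section \<open>Characters of the integers modulo m\<close>

text \<open>The base is a primitive \<open>m\<close>-th root of unity: its powers enumerate all \<open>m\<close>-th roots of unity without
  repetition, so only exponents congruent to \<open>0\<close> give \<open>1\<close>.\<close>
lemma exp_eq_1_iff_dvd:
  assumes "m > 0"
  shows "exp (2 * of_real pi * \<i> / of_nat m) powi a = (1::complex) \<longleftrightarrow> int m dvd a"
proof -
  let ?w = "exp (2 * of_real pi * \<i> / of_nat m) :: complex"
  have w: "?w ^ k = cis (2 * pi * real k / real m)" for k
    by (simp add: exp_of_nat_mult[symmetric] cis_conv_exp mult_ac)
  have nz: "?w \<noteq> 0" by simp
  have inj: "inj_on (\<lambda>k. ?w ^ k) {..<m}"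
    using bij_betw_roots_unity[OF assms] unfolding w bij_betw_def by simp
  have wm: "?w ^ m = 1" using assms by (simp add: w)
  have red: "?w powi a = ?w ^ nat (a mod int m)"
  proof -
    have "?w powi a = ?w powi (int m * (a div int m) + a mod int m)" by simp
    also have "\<dots> = (?w powi int m) powi (a div int m) * ?w powi (a mod int m)"
      by (subst power_int_add) (use nz in \<open>auto simp: power_int_mult\<close>)
    also have "\<dots> = ?w ^ nat (a mod int m)"
      using wm assms by (simp add: power_int_nonneg_exp)
    finally show ?thesis .
  qed
  have "?w powi a = 1 \<longleftrightarrow> nat (a mod int m) = 0"
    unfolding red using inj_onD[OF inj, of "nat (a mod int m)" 0] assms
    by (auto simp: nat_less_iff)
  also have "\<dots> \<longleftrightarrow> int m dvd a" using assms by (auto simp: dvd_eq_mod_eq_0 intro: antisym)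
  finally show ?thesis .
qed

context
  fixes m :: nat
begin

lemma chi_add: "chi m \<alpha> (a + b) = chi m \<alpha> a * chi m \<alpha> b"
  by (simp add: chi_def power_int_add ring_distribs)

lemma chi_add_char: "chi m (\<alpha> + \<beta>) a = chi m \<alpha> a * chi m \<beta> a"
  by (simp add: chi_def power_int_add ring_distribs)

lemma chi_minus_char: "chi m (- \<alpha>) a = chi m \<alpha> (- a)"
  by (simp add: chi_def)

lemma chi_commute: "chi m \<alpha> \<beta> = chi m \<beta> \<alpha>"
  by (simp add: chi_def mult.commute)

lemma chi_zero [simp]: "chi m \<alpha> 0 = 1" "chi m 0 \<alpha> = 1"
  by (simp_all add: chi_def)

lemma chi_nonzero [simp]: "chi m \<alpha> a \<noteq> 0"
  by (simp add: chi_def)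

lemma cnj_chi: "cnj (chi m \<alpha> a) = chi m \<alpha> (- a)"
proof -
  let ?w = "exp (2 * of_real pi * \<i> / of_nat m) :: complex"
  have "cnj ?w = inverse ?w"
    using cis_cnj[of "2 * pi / real m"] by (simp add: cis_conv_exp cis_inverse exp_minus[symmetric] mult_ac)
  then have "cnj (?w powi k) = ?w powi (-k)" for k
    by (simp add: power_int_inverse power_int_minus power_int_def power_inverse)
  then show ?thesis by (simp add: chi_def)
qed

context
  assumes m: "m > 0"
begin

lemma chi_eq_1: "int m dvd a \<Longrightarrow> chi m \<alpha> a = 1"  "int m dvd \<alpha> \<Longrightarrow> chi m \<alpha> a = 1"
  using exp_eq_1_iff_dvd[OF m, of "a * \<alpha>"] by (auto simp: chi_def)

lemma chi_cong:
  assumes "int m dvd a - b"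
  shows "chi m \<alpha> a = chi m \<alpha> b"
  using chi_add[of \<alpha> "a - b" b] chi_eq_1(1)[OF assms, of \<alpha>] by simp

lemma chi_cong_char:
  assumes "int m dvd \<alpha> - \<beta>"
  shows "chi m \<alpha> a = chi m \<beta> a"
  using chi_cong[OF assms, of a] by (simp add: chi_commute)

lemma sum_chi: "(\<Sum>z<m. chi m \<alpha> (int z)) = (if int m dvd \<alpha> then of_nat m else 0)"
proof -
  let ?x = "exp (2 * of_real pi * \<i> / of_nat m) powi \<alpha> :: complex"
  have *: "chi m \<alpha> (int z) = ?x ^ z" for z
    by (simp add: chi_def power_int_power' mult.commute)
  have xm: "?x ^ m = 1" using chi_eq_1(1)[of "int m" \<alpha>] by (simp add: *)
  show ?thesis
  proof (cases "int m dvd \<alpha>")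
    case True
    then show ?thesis by (simp add: chi_eq_1)
  next
    case False
    then have "?x \<noteq> 1" using exp_eq_1_iff_dvd[OF m, of \<alpha>] by simp
    then show ?thesis using False unfolding * by (simp add: geometric_sum xm del: power_int_power')
  qed
qed

text \<open>This sum over an in-block position occurs when a diagonal block, with entries depending on \<open>z - x\<close>,
  stands on the left; it forces the two characters to agree.\<close>
lemma sum_chi_convolution:
  "(\<Sum>z<m. chi m \<alpha> (a + int z) * chi m \<beta> (b - int z)) =
     (if int m dvd \<alpha> - \<beta> then of_nat m * chi m \<alpha> (a + b) else 0)"
proof -
  have "chi m \<alpha> (a + int z) * chi m \<beta> (b - int z) = chi m \<alpha> a * chi m \<beta> b * chi m (\<alpha> - \<beta>) (int z)" for z
    using chi_add_char[of \<alpha> "-\<beta>" "int z"] chi_add[of \<alpha> a "int z"] chi_add[of \<beta> b "- int z"]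
    by (simp add: chi_minus_char)
  then have "(\<Sum>z<m. chi m \<alpha> (a + int z) * chi m \<beta> (b - int z)) =
      chi m \<alpha> a * chi m \<beta> b * (\<Sum>z<m. chi m (\<alpha> - \<beta>) (int z))"
    by (simp only: sum_distrib_left)
  then show ?thesis using chi_cong_char[of \<alpha> \<beta> b] by (simp add: sum_chi chi_add)
qed

text \<open>With an off-diagonal block on the left, whose entries depend on \<open>- x - z\<close>, the position \<open>z\<close> enters both
  factors with the same sign, so the characters must be inverse to each other.\<close>
lemma sum_chi_correlation:
  "(\<Sum>z<m. chi m \<alpha> (a - int z) * chi m \<beta> (b - int z)) =
     (if int m dvd \<alpha> + \<beta> then of_nat m * chi m \<alpha> (a - b) else 0)"
proof -
  have "chi m \<alpha> (a - int z) = chi m (-\<alpha>) (- a + int z)" for z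
    by (simp add: chi_minus_char)
  moreover have "int m dvd - \<alpha> - \<beta> \<longleftrightarrow> int m dvd \<alpha> + \<beta>"
    using dvd_minus_iff[of "int m" "\<alpha> + \<beta>"] by simp
  ultimately show ?thesis using sum_chi_convolution[of "-\<alpha>" "-a" \<beta> b]
    by (simp add: chi_minus_char)
qed

text \<open>In each position of its blocks, exactly one adjacency matrix of a given kind has the entry \<open>1\<close>: the one whose
  index is congruent to a number \<open>k\<close> determined by the position.  Its character value is all that remains of
  the sum.\<close>
lemma fourier_delta:
  "(\<Sum>z<m. chi m \<alpha> (int z) * of_bool (int m dvd int z - k)) = chi m \<alpha> k"
proof -
  have *: "int m dvd int z - k \<longleftrightarrow> z = nat (k mod int m)" if "z < m" for z
  proof -
    have "int m dvd int z - k \<longleftrightarrow> int z mod int m = k mod int m"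
      by (simp add: mod_eq_dvd_iff)
    also have "\<dots> \<longleftrightarrow> z = nat (k mod int m)" using that by (auto)
    finally show ?thesis .
  qed
  have "(\<Sum>z<m. chi m \<alpha> (int z) * of_bool (int m dvd int z - k)) =
    (\<Sum>z<m. if z = nat (k mod int m) then chi m \<alpha> (int z) else 0)"
    by (intro sum.cong) (auto simp: *)
  also have "\<dots> = chi m \<alpha> (int (nat (k mod int m)))"
    using m by (simp add: nat_less_iff)
  also have "\<dots> = chi m \<alpha> k" using m by (intro chi_cong) (simp add: mod_eq_dvd_iff[symmetric])
  finally show ?thesis .
qed

end
end

section \<open>Spans of matrices and bases of matrix units\<close>

text \<open>By definition \<open>adjacency_algebra\<close> is the linear span of an arbitrary set of square matrices, and it is
  used below as such, also for the set of components.\<close>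
lemma adjacency_algebra_facts:
  fixes S :: "complex mat set"
  assumes S: "S \<subseteq> carrier_mat N N"
  shows adjacency_algebra_base: "x \<in> S \<Longrightarrow> x \<in> adjacency_algebra N S"
    and adjacency_algebra_add: "x \<in> adjacency_algebra N S \<Longrightarrow> y \<in> adjacency_algebra N S \<Longrightarrow> x + y \<in> adjacency_algebra N S"
    and adjacency_algebra_smult: "x \<in> adjacency_algebra N S \<Longrightarrow> a \<cdot>\<^sub>m x \<in> adjacency_algebra N S"
    and adjacency_algebra_zero: "0\<^sub>m N N \<in> adjacency_algebra N S"
    and adjacency_algebra_submodule:
      "submodule class_ring (adjacency_algebra N S) (module_mat TYPE(complex) N N)"
proof -
  interpret vectorspace class_ring "module_mat TYPE(complex) N N" by (rule matrix_vs)
  have c: "S \<subseteq> carrier (module_mat TYPE(complex) N N)" using S by (simp add: module_mat_simps)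
  interpret sp: submodule class_ring "adjacency_algebra N S" "module_mat TYPE(complex) N N"
    unfolding adjacency_algebra_def by (rule span_is_submodule[OF c])
  show "x \<in> S \<Longrightarrow> x \<in> adjacency_algebra N S"
    using in_own_span[OF c] by (auto simp: adjacency_algebra_def)
  show "x \<in> adjacency_algebra N S \<Longrightarrow> y \<in> adjacency_algebra N S \<Longrightarrow> x + y \<in> adjacency_algebra N S"
    using sp.m_closed[of x y] by (simp add: module_mat_simps)
  show "x \<in> adjacency_algebra N S \<Longrightarrow> a \<cdot>\<^sub>m x \<in> adjacency_algebra N S"
    using sp.smult_closed[of a x] by (simp add: module_mat_simps class_ring_simps)
  show "0\<^sub>m N N \<in> adjacency_algebra N S"
    using sp.zero_closed by (simp add: module_mat_simps)
  show "submodule class_ring (adjacency_algebra N S) (module_mat TYPE(complex) N N)"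
    by (rule sp.submodule_axioms)
qed

lemma adjacency_algebra_least:
  assumes "S \<subseteq> V" "submodule class_ring V (module_mat TYPE(complex) N N)"
  shows "adjacency_algebra N S \<subseteq> V"
proof -
  interpret vectorspace class_ring "module_mat TYPE(complex) N N" by (rule matrix_vs)
  show ?thesis unfolding adjacency_algebra_def by (rule span_is_subset[OF assms])
qed

lemma finsum_mat_closed_index:
  assumes "finite I" and "\<And>i. i \<in> I \<Longrightarrow> f i \<in> carrier_mat N N"
  shows finsum_mat_carrier: "finsum (module_mat TYPE(complex) N N) f I \<in> carrier_mat N N"
    and finsum_mat_index: "r < N \<Longrightarrow> c < N \<Longrightarrow>
      finsum (module_mat TYPE(complex) N N) f I $$ (r,c) = (\<Sum>i\<in>I. f i $$ (r,c))"
    and finsum_mat_in_adjacency_algebra: "S \<subseteq> carrier_mat N N \<Longrightarrow>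
      (\<And>i. i \<in> I \<Longrightarrow> f i \<in> adjacency_algebra N S) \<Longrightarrow>
      finsum (module_mat TYPE(complex) N N) f I \<in> adjacency_algebra N S"
proof -
  interpret vectorspace class_ring "module_mat TYPE(complex) N N" by (rule matrix_vs)
  let ?s = "finsum (module_mat TYPE(complex) N N) f"
  have "?s I \<in> carrier_mat N N \<and>
    (r < N \<longrightarrow> c < N \<longrightarrow> ?s I $$ (r,c) = (\<Sum>i\<in>I. f i $$ (r,c))) \<and>
    (S \<subseteq> carrier_mat N N \<longrightarrow> (\<forall>i\<in>I. f i \<in> adjacency_algebra N S) \<longrightarrow> ?s I \<in> adjacency_algebra N S)"
    for r c S
    using assms
  proof (induction I rule: finite_induct)
    case empty
    then show ?case by (simp add: module_mat_simps adjacency_algebra_zero)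
  next
    case (insert i I)
    have "?s (insert i I) = f i + ?s I"
      using insert by (subst M.finsum_insert) (auto simp: module_mat_simps)
    then show ?case using insert by (auto intro: adjacency_algebra_add)
  qed
  then show "?s I \<in> carrier_mat N N"
    "r < N \<Longrightarrow> c < N \<Longrightarrow> ?s I $$ (r,c) = (\<Sum>i\<in>I. f i $$ (r,c))"
    "S \<subseteq> carrier_mat N N \<Longrightarrow> (\<And>i. i \<in> I \<Longrightarrow> f i \<in> adjacency_algebra N S) \<Longrightarrow> ?s I \<in> adjacency_algebra N S"
    for r c S by blast+
qed

text \<open>Linear independence will be tested by such sandwich maps: a vector not annihilated by one of them is
  outside the span of any set of annihilated vectors.\<close>
lemma sandwich_kernel_submodule:
  assumes L: "L \<in> carrier_mat N N" and R: "R \<in> carrier_mat N N"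
  shows "submodule class_ring {v \<in> carrier_mat N N. L * v * R = 0\<^sub>m N N} (module_mat TYPE(complex) N N)"
proof -
  interpret vectorspace class_ring "module_mat TYPE(complex) N N" by (rule matrix_vs)
  show ?thesis
  proof (unfold_locales, goal_cases)
    case (2 v w)
    then have v: "v \<in> carrier_mat N N" "w \<in> carrier_mat N N" by auto
    have "L * (v + w) * R = L * v * R + L * w * R"
      using L R v by (simp add: mult_add_distrib_mat[OF L v]
          add_mult_distrib_mat[OF mult_carrier_mat[OF L v(1)] mult_carrier_mat[OF L v(2)] R])
    then show ?case using 2 by (simp add: module_mat_simps)
  next
    case (4 a v)
    then have v: "v \<in> carrier_mat N N" by auto
    have "L * (a \<cdot>\<^sub>m v) * R = a \<cdot>\<^sub>m (L * v * R)"
      using mult_smult_distrib[OF L v] mult_smult_assoc_mat[OF mult_carrier_mat[OF L v] R] by simp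
    then show ?case using 4 by (simp add: module_mat_simps)
  qed (use L R in \<open>auto simp: module_mat_simps\<close>)
qed

text \<open>The maps \<open>v \<mapsto> L x * v * R x\<close> play the role of a dual basis: each one annihilates all members of the family
  but its own.  Hence no member is in the span of the others.\<close>
lemma basis_if_separated:
  assumes fin_X: "finite X" and f: "\<And>x. x \<in> X \<Longrightarrow> f x \<in> carrier_mat N N"
    and LR: "\<And>x. x \<in> X \<Longrightarrow> L x \<in> carrier_mat N N" "\<And>x. x \<in> X \<Longrightarrow> R x \<in> carrier_mat N N"
    and kill: "\<And>x y. x \<in> X \<Longrightarrow> y \<in> X \<Longrightarrow> x \<noteq> y \<Longrightarrow> L x * f y * R x = 0\<^sub>m N N"
    and keep: "\<And>x. x \<in> X \<Longrightarrow> L x * f x * R x \<noteq> 0\<^sub>m N N"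
    and gen: "adjacency_algebra N S = adjacency_algebra N (f ` X)"
  shows "inj_on f X"
    and "vectorspace.basis class_ring ((module_mat TYPE(complex) N N)\<lparr>carrier := adjacency_algebra N S\<rparr>) (f ` X)"
proof -
  show inj: "inj_on f X" by (rule inj_onI) (metis kill keep)
  let ?V = "module_mat TYPE(complex) N N"
  let ?B = "f ` X"
  let ?A = "adjacency_algebra N ?B"
  interpret vectorspace class_ring ?V by (rule matrix_vs)
  have B: "?B \<subseteq> carrier_mat N N" using f by auto
  have fin_B: "finite ?B" using fin_X by simp
  have indep: "lin_indpt ?B"
  proof
    assume "lin_dep ?B"
    have BV: "?B \<subseteq> carrier ?V" using B by (simp add: module_mat_simps)
    have "\<exists>v\<in>?B. v \<in> span (?B - {v})"
      using lindep_span[OF BV fin_B] \<open>lin_dep ?B\<close> by (rule iffD1)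
    then obtain v where v: "v \<in> ?B" "v \<in> span (?B - {v})" ..
    then obtain x where x: "x \<in> X" "v = f x" by auto
    have "?B - {v} \<subseteq> {w \<in> carrier_mat N N. L x * w * R x = 0\<^sub>m N N}"
      using kill[OF x(1)] x f by auto
    from adjacency_algebra_least[OF this sandwich_kernel_submodule] LR[OF x(1)] v(2)
    have "L x * v * R x = 0\<^sub>m N N" by (auto simp: adjacency_algebra_def)
    with keep x show False by auto
  qed
  note sub = adjacency_algebra_submodule[OF B]
  have BA: "?B \<subseteq> ?A" using adjacency_algebra_base[OF B] by auto
  have "VectorSpace.subspace class_ring ?A ?V"
    using sub vectorspace_axioms by (simp add: VectorSpace.subspace_def)
  then interpret W: vectorspace class_ring "?V\<lparr>carrier := ?A\<rparr>" by (rule subspace_is_vs)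
  show "vectorspace.basis class_ring (?V\<lparr>carrier := adjacency_algebra N S\<rparr>) ?B"
    unfolding gen W.basis_def
    using span_li_not_depend[OF BA sub] indep BA by (auto simp: adjacency_algebra_def)
qed

text \<open>The multiplication rules of matrix units imply independence.  The product \<open>D\<^sub>1\<^sub>j\<^sup>\<alpha> v D\<^sub>k\<^sub>1\<^sup>\<alpha>\<close> picks out the
  coefficient of \<open>D\<^sub>j\<^sub>k\<^sup>\<alpha>\<close> in \<open>v\<close>, as a multiple of \<open>D\<^sub>1\<^sub>1\<^sup>\<alpha>\<close>, and \<open>E\<^sub>i v E\<^sub>i\<close> picks out that of \<open>E\<^sub>i\<close>.  So it is
  enough that \<open>E\<^sub>i\<close> and \<open>D\<^sub>1\<^sub>1\<^sup>\<alpha>\<close> are nonzero and that both families have the same span.\<close>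
lemma wedderburn_decompositionI:
  fixes E :: "'i \<Rightarrow> complex mat" and D :: "'p \<Rightarrow> nat \<Rightarrow> nat \<Rightarrow> complex mat"
  assumes fin: "finite I" "finite P"
    and S: "S \<subseteq> carrier_mat N N"
    and E: "\<And>i. i \<in> I \<Longrightarrow> E i \<in> carrier_mat N N"
    and D: "\<And>\<alpha> j k. \<alpha> \<in> P \<Longrightarrow> j \<in> {1,2} \<Longrightarrow> k \<in> {1,2} \<Longrightarrow> D \<alpha> j k \<in> carrier_mat N N"
    and E_nz: "\<And>i. i \<in> I \<Longrightarrow> E i \<noteq> 0\<^sub>m N N"
    and D_nz: "\<And>\<alpha>. \<alpha> \<in> P \<Longrightarrow> D \<alpha> 1 1 \<noteq> 0\<^sub>m N N"
    and EE: "\<And>i i'. i \<in> I \<Longrightarrow> i' \<in> I \<Longrightarrow> E i * E i' = (if i = i' then E i else 0\<^sub>m N N)"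
    and ED: "\<And>i \<alpha> j k. i \<in> I \<Longrightarrow> \<alpha> \<in> P \<Longrightarrow> j \<in> {1,2} \<Longrightarrow> k \<in> {1,2} \<Longrightarrow> E i * D \<alpha> j k = 0\<^sub>m N N"
    and DE: "\<And>i \<alpha> j k. i \<in> I \<Longrightarrow> \<alpha> \<in> P \<Longrightarrow> j \<in> {1,2} \<Longrightarrow> k \<in> {1,2} \<Longrightarrow> D \<alpha> j k * E i = 0\<^sub>m N N"
    and DD: "\<And>\<alpha> \<beta> j k j' k'. \<alpha> \<in> P \<Longrightarrow> \<beta> \<in> P \<Longrightarrow> j \<in> {1,2} \<Longrightarrow> k \<in> {1,2} \<Longrightarrow> j' \<in> {1,2} \<Longrightarrow> k' \<in> {1,2} \<Longrightarrow>
      D \<alpha> j k * D \<beta> j' k' = (if \<alpha> = \<beta> \<and> k = j' then D \<alpha> j k' else 0\<^sub>m N N)"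
    and E_adj: "\<And>i. i \<in> I \<Longrightarrow> mat_adjoint (E i) = E i"
    and D_adj: "\<And>\<alpha> j k. \<alpha> \<in> P \<Longrightarrow> j \<in> {1,2} \<Longrightarrow> k \<in> {1,2} \<Longrightarrow> mat_adjoint (D \<alpha> j k) = D \<alpha> k j"
    and E_in: "\<And>i. i \<in> I \<Longrightarrow> E i \<in> adjacency_algebra N S"
    and D_in: "\<And>\<alpha> j k. \<alpha> \<in> P \<Longrightarrow> j \<in> {1,2} \<Longrightarrow> k \<in> {1,2} \<Longrightarrow> D \<alpha> j k \<in> adjacency_algebra N S"
    and gen: "S \<subseteq> adjacency_algebra N (E ` I \<union> {D \<alpha> j k | \<alpha> j k. \<alpha> \<in> P \<and> j \<in> {1,2} \<and> k \<in> {1,2}})"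
  shows "wedderburn_decomposition N (adjacency_algebra N S) I E P D"
proof -
  define fam :: "'i + 'p \<times> nat \<times> nat \<Rightarrow> complex mat" where "fam = case_sum E (\<lambda>(\<alpha>,j,k). D \<alpha> j k)"
  define X :: "('i + 'p \<times> nat \<times> nat) set" where "X = I <+> P \<times> {1,2} \<times> {1,2}"
  define L :: "'i + 'p \<times> nat \<times> nat \<Rightarrow> complex mat" where "L = case_sum E (\<lambda>(\<alpha>,j,k). D \<alpha> 1 j)"
  define R :: "'i + 'p \<times> nat \<times> nat \<Rightarrow> complex mat" where "R = case_sum E (\<lambda>(\<alpha>,j,k). D \<alpha> k 1)"
  have img: "fam ` X = E ` I \<union> {D \<alpha> j k | \<alpha> j k. \<alpha> \<in> P \<and> j \<in> {1,2} \<and> k \<in> {1,2}}"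
    by (force simp: fam_def X_def Plus_def image_Un image_iff)
  have c: "fam x \<in> carrier_mat N N" "L x \<in> carrier_mat N N" "R x \<in> carrier_mat N N" if "x \<in> X" for x
    using that E D by (auto simp: X_def fam_def L_def R_def)
  have S_fam: "fam ` X \<subseteq> carrier_mat N N" using c by auto
  have sandwich: "L x * fam y * R x =
      (if x = y then case x of Inl i \<Rightarrow> E i | Inr (\<alpha>,_) \<Rightarrow> D \<alpha> 1 1 else 0\<^sub>m N N)"
    if xy: "x \<in> X" "y \<in> X" for x y
  proof -
    have zl: "0\<^sub>m N N * R x = 0\<^sub>m N N" using c(3)[OF xy(1)] by simp
    have one: "1 \<in> {1, 2::nat}" by simp
    consider (EE) i i' where "x = Inl i" "y = Inl i'" "i \<in> I" "i' \<in> I"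
      | (ED) i \<beta> j' k' where "x = Inl i" "y = Inr (\<beta>,j',k')" "i \<in> I" "\<beta> \<in> P" "j' \<in> {1,2}" "k' \<in> {1,2}"
      | (DE) \<alpha> j k i' where "x = Inr (\<alpha>,j,k)" "y = Inl i'" "i' \<in> I" "\<alpha> \<in> P" "j \<in> {1,2}" "k \<in> {1,2}"
      | (DD) \<alpha> j k \<beta> j' k' where "x = Inr (\<alpha>,j,k)" "y = Inr (\<beta>,j',k')" "\<alpha> \<in> P" "\<beta> \<in> P"
          "j \<in> {1,2}" "k \<in> {1,2}" "j' \<in> {1,2}" "k' \<in> {1,2}"
      using xy unfolding X_def by blast
    then show ?thesis
    proof cases
      case EE
      then show ?thesis using zl by (simp add: L_def R_def fam_def assms(8))
    next
      case ED
      then show ?thesis using zl by (simp add: L_def R_def fam_def assms(9))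
    next
      case DE
      then show ?thesis using zl assms(10)[OF DE(3,4) one DE(5)] by (simp add: L_def R_def fam_def)
    next
      case DD
      have l: "L x * fam y = (if \<alpha> = \<beta> \<and> j = j' then D \<alpha> 1 k' else 0\<^sub>m N N)"
        using assms(11)[OF DD(3,4) one DD(5,7,8)] DD by (simp add: L_def fam_def)
      have r: "D \<alpha> 1 k' * R x = (if k' = k then D \<alpha> 1 1 else 0\<^sub>m N N)"
        using assms(11)[OF DD(3,3) one DD(8,6) one] DD by (simp add: R_def)
      have "L x * fam y * R x = (if (\<alpha>,j,k) = (\<beta>,j',k') then D \<alpha> 1 1 else 0\<^sub>m N N)"
        unfolding l using r zl by (cases "\<alpha> = \<beta> \<and> j = j'") auto
      then show ?thesis using DD(1,2) by simp
    qed
  qed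
  have gen': "adjacency_algebra N S = adjacency_algebra N (fam ` X)"
  proof
    show "adjacency_algebra N S \<subseteq> adjacency_algebra N (fam ` X)"
      using gen unfolding img[symmetric]
      by (rule adjacency_algebra_least[OF _ adjacency_algebra_submodule[OF S_fam]])
    have "fam ` X \<subseteq> adjacency_algebra N S" unfolding img using E_in D_in by blast
    then show "adjacency_algebra N (fam ` X) \<subseteq> adjacency_algebra N S"
      by (rule adjacency_algebra_least[OF _ adjacency_algebra_submodule[OF S]])
  qed
  have fin_X: "finite X" using fin by (simp add: X_def)
  have kill: "L x * fam y * R x = 0\<^sub>m N N" if "x \<in> X" "y \<in> X" "x \<noteq> y" for x y
    using sandwich[OF that(1,2)] that(3) by simp
  have keep: "L x * fam x * R x \<noteq> 0\<^sub>m N N" if "x \<in> X" for x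
  proof -
    have "(case x of Inl i \<Rightarrow> E i | Inr (\<alpha>,_) \<Rightarrow> D \<alpha> 1 1) \<noteq> 0\<^sub>m N N"
      using that E_nz D_nz by (cases x) (auto simp: X_def)
    then show ?thesis unfolding sandwich[OF that that] by simp
  qed
  note basis = basis_if_separated[OF fin_X c kill keep gen']
  show ?thesis
    unfolding wedderburn_decomposition_def Let_def fam_def[symmetric] X_def[symmetric]
    by (intro conjI ballI basis EE ED DE DD E_adj D_adj)
qed

section \<open>The multiplication rule for Fourier transforms\<close>

lemma sum_blocks:
  fixes g :: "nat \<Rightarrow> 'a::comm_monoid_add"
  shows "(\<Sum>s<k*m. g s) = (\<Sum>l<k. \<Sum>z<m. g (l*m+z))"
proof -
  have "(\<Sum>l<k. sum g {l*m..<l*m+m}) = (\<Sum>s<k*m. g s)" by (rule sum.nat_group)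
  moreover have "sum g {l*m..<l*m+m} = (\<Sum>z<m. g (l*m+z))" for l
    using sum.shift_bounds_nat_ivl[of g 0 "l*m" m] by (simp add: lessThan_atLeast0 add.commute)
  ultimately show ?thesis by simp
qed

text \<open>These are the matrices \<open>p F\<^sub>\<alpha>\<^sub>,\<^sub>0 + q F\<^sub>\<alpha>\<^sub>,\<^sub>1\<close> with their character sums evaluated (\<open>F_eq_X\<close> below); \<open>e i j\<close> is
  the exponent of the entry \<open>(i,j)\<close> of the BGW matrix.  A global index \<open>r\<close> may stand in place of the
  in-block position \<open>r mod m\<close>, because \<open>chi m \<alpha>\<close> has period \<open>m\<close>.\<close>
definition fourier_mat :: "nat \<Rightarrow> nat \<Rightarrow> (nat \<Rightarrow> nat \<Rightarrow> int) \<Rightarrow> int \<Rightarrow> complex \<Rightarrow> complex \<Rightarrow> complex mat" where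
  "fourier_mat n m e \<alpha> p q = mat ((n + 1) * m) ((n + 1) * m) (\<lambda>(r,c).
     if r div m = c div m then p * chi m \<alpha> (int c - int r)
     else q * chi m \<alpha> (- int r - int c - 1 - e (r div m) (c div m)))"

text \<open>The assumption \<open>balanced\<close> is the Fourier transform of the defining property of a BGW matrix: the
  differences of two rows of exponents are equidistributed modulo \<open>m\<close>, hence annihilated by all
  nontrivial characters, and there are \<open>n - 1\<close> of them.\<close>
locale balanced_exponents =
  fixes n m :: nat and e :: "nat \<Rightarrow> nat \<Rightarrow> int"
  assumes n: "n > 0" and m: "m > 0"
    and sym: "\<And>i j. i < n + 1 \<Longrightarrow> j < n + 1 \<Longrightarrow> e i j = e j i"
    and balanced: "\<And>i j \<alpha>. i < n + 1 \<Longrightarrow> j < n + 1 \<Longrightarrow> i \<noteq> j \<Longrightarrow>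
      (\<Sum>k\<in>{..<n + 1} - {i,j}. chi m \<alpha> (e k j - e i k)) = (if int m dvd \<alpha> then of_nat n - 1 else 0)"
begin

definition N where "N = (n + 1) * m"

lemma block_index: "r < N \<Longrightarrow> r div m < n + 1"
  by (simp add: N_def less_mult_imp_div_less)

abbreviation X where "X \<equiv> fourier_mat n m e"

lemma X_carrier [simp]: "X \<alpha> p q \<in> carrier_mat N N"
  by (simp add: fourier_mat_def N_def)

lemma X_dims [simp]: "dim_row (X \<alpha> p q) = N" "dim_col (X \<alpha> p q) = N"
  by (simp_all add: fourier_mat_def N_def)

lemma X_index:
  assumes "r < N" "c < N"
  shows "X \<alpha> p q $$ (r,c) = (if r div m = c div m then p * chi m \<alpha> (int c - int r)
     else q * chi m \<alpha> (- int r - int c - 1 - e (r div m) (c div m)))"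
  using assms unfolding N_def by (simp add: fourier_mat_def)

lemma X_zero: "X \<alpha> 0 0 = 0\<^sub>m N N"
  by (rule eq_matI) (simp_all add: X_index)

lemma X_add: "X \<alpha> p q + X \<alpha> s t = X \<alpha> (p + s) (q + t)"
  by (rule eq_matI) (simp_all add: X_index ring_distribs)

lemma X_diff: "X \<alpha> p q - X \<alpha> s t = X \<alpha> (p - s) (q - t)"
  by (rule eq_matI) (simp_all add: X_index ring_distribs)

lemma X_smult: "a \<cdot>\<^sub>m X \<alpha> p q = X \<alpha> (a * p) (a * q)"
  by (rule eq_matI) (simp_all add: X_index)

lemma X_cong: "int m dvd \<alpha> - \<beta> \<Longrightarrow> X \<alpha> p q = X \<beta> p q"
  by (rule eq_matI) (simp_all add: X_index chi_cong_char[OF m, of \<alpha> \<beta>])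

lemma X_eq_zero_iff: "X \<alpha> p q = 0\<^sub>m N N \<longleftrightarrow> p = 0 \<and> q = 0"
proof
  assume z: "X \<alpha> p q = 0\<^sub>m N N"
  have l: "0 < N" "m < N" using n m by (auto simp: N_def)
  have "X \<alpha> p q $$ (0,0) = 0" "X \<alpha> p q $$ (0,m) = 0" using l unfolding z by auto
  with l show "p = 0 \<and> q = 0" using m by (auto simp: X_index)
qed (simp add: X_zero)

text \<open>The factor \<open>a\<close> belongs to the products with \<open>F\<^sub>\<alpha>\<^sub>,\<^sub>0\<close> on the left and \<open>b\<close> to those with \<open>F\<^sub>\<alpha>\<^sub>,\<^sub>1\<close>.  The summand
  with \<open>n - 1\<close> comes from the off-diagonal blocks of \<open>F\<^sub>\<alpha>\<^sub>,\<^sub>1 F\<^sub>-\<^sub>\<alpha>\<^sub>,\<^sub>1\<close>, which \<open>balanced\<close> makes vanish unless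
  \<open>\<alpha>\<close> is trivial; for trivial \<open>\<alpha>\<close> all character values are \<open>1\<close>, so what remains is a multiple of \<open>F\<^sub>0\<^sub>,\<^sub>1\<close>.\<close>
lemma X_mult:
  "X \<alpha> p q * X \<beta> s t =
   (let a = of_bool (int m dvd \<alpha> - \<beta>); b = of_bool (int m dvd \<alpha> + \<beta>); z = of_bool (int m dvd \<alpha>)
    in X \<alpha> (of_nat m * (a * p * s + b * of_nat n * q * t))
           (of_nat m * (a * p * t + b * q * s + b * z * (of_nat n - 1) * q * t)))"
proof (unfold Let_def, rule eq_matI, goal_cases)
  case (1 r c)
  define i j where "i = r div m" and "j = c div m"
  define a b z :: complex where "a = of_bool (int m dvd \<alpha> - \<beta>)"
    and "b = of_bool (int m dvd \<alpha> + \<beta>)" and "z = of_bool (int m dvd \<alpha>)"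
  have rc: "r < N" "c < N" using 1 by simp_all
  have ij: "i < n + 1" "j < n + 1" using rc by (simp_all only: i_def j_def block_index)
  \<comment> \<open>the contribution of the \<open>k\<close>-th block column of the left factor\<close>
  define T where "T k = (\<Sum>y<m. X \<alpha> p q $$ (r, k*m+y) * X \<beta> s t $$ (k*m+y, c))" for k
  have conv: "(\<Sum>y<m. chi m \<alpha> (A + int y) * chi m \<beta> (B - int y)) = of_nat m * a * chi m \<alpha> (A + B)" for A B
    by (simp add: sum_chi_convolution[OF m] a_def)
  have corr: "(\<Sum>y<m. chi m \<alpha> (A - int y) * chi m \<beta> (B - int y)) = of_nat m * b * chi m \<alpha> (A - B)" for A B
    by (simp add: sum_chi_correlation[OF m] b_def)
  have T: "T k = of_nat m *
      (if i = k then if k = j then a * p * s * chi m \<alpha> (int c - int r)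
                     else a * p * t * chi m \<alpha> (- int r - int c - 1 - e i j)
       else if k = j then b * q * s * chi m \<alpha> (- int r - int c - 1 - e i j)
       else b * q * t * chi m \<alpha> (int c - int r) * chi m \<alpha> (e k j - e i k))"
    if k: "k < n + 1" for k
  proof -
    have bd: "k*m+y < N" if "y < m" for y
    proof -
      have "k*m+y < (k+1)*m" using that by simp
      also have "\<dots> \<le> N" unfolding N_def using k by (intro mult_le_mono1) simp
      finally show ?thesis .
    qed
    have left: "X \<alpha> p q $$ (r, k*m+y) = (if i = k then p * chi m \<alpha> ((- int r) + int y)
        else q * chi m \<alpha> ((- int r - 1 - e i k) - int y))" if "y < m" for y
      using rc bd[OF that] that m unfolding i_def
      by (auto simp: X_index intro!: chi_cong[OF m])
    have right: "X \<beta> s t $$ (k*m+y, c) = (if k = j then s * chi m \<beta> (int c - int y)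
        else t * chi m \<beta> ((- int c - 1 - e k j) - int y))" if "y < m" for y
      using rc bd[OF that] that m unfolding j_def
      by (auto simp: X_index intro!: chi_cong[OF m])
    have "T k = (\<Sum>y<m. (if i = k then p * chi m \<alpha> ((- int r) + int y)
        else q * chi m \<alpha> ((- int r - 1 - e i k) - int y)) * (if k = j then s * chi m \<beta> (int c - int y)
        else t * chi m \<beta> ((- int c - 1 - e k j) - int y)))"
      unfolding T_def by (intro sum.cong) (simp_all add: left right)
    also have "\<dots> = (if i = k then p else q) * (if k = j then s else t) *
       (if i = k then if k = j then of_nat m * a * chi m \<alpha> ((- int r) + int c)
                      else of_nat m * a * chi m \<alpha> ((- int r) + (- int c - 1 - e k j))
        else if k = j then of_nat m * b * chi m \<alpha> ((- int r - 1 - e i k) - int c)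
        else of_nat m * b * chi m \<alpha> ((- int r - 1 - e i k) - (- int c - 1 - e k j)))"
      unfolding conv[symmetric] corr[symmetric] by (simp add: sum_distrib_left mult_ac)
    also have "chi m \<alpha> ((- int r - 1 - e i k) - (- int c - 1 - e k j)) =
        chi m \<alpha> (int c - int r) * chi m \<alpha> (e k j - e i k)"
      unfolding chi_add[symmetric] by (simp add: algebra_simps)
    also have "(- int r) + (- int c - 1 - e k j) = - int r - int c - 1 - e k j" by simp
    also have "(- int r - 1 - e i k) - int c = - int r - int c - 1 - e i k" by simp
    also have "(- int r) + int c = int c - int r" by simp
    finally show ?thesis by (auto simp: mult_ac)
  qed
  have "(X \<alpha> p q * X \<beta> s t) $$ (r,c) = (\<Sum>l<N. X \<alpha> p q $$ (r,l) * X \<beta> s t $$ (l,c))"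
    using rc by (simp add: scalar_prod_def lessThan_atLeast0)
  also have "\<dots> = (\<Sum>k<n+1. T k)" unfolding N_def T_def by (rule sum_blocks)
  also have "\<dots> = (if i = j
      then of_nat m * (a * p * s + b * of_nat n * q * t) * chi m \<alpha> (int c - int r)
      else of_nat m * (a * p * t + b * q * s + b * z * (of_nat n - 1) * q * t)
        * chi m \<alpha> (- int r - int c - 1 - e i j))"
  proof (cases "i = j")
    case True
    have "(\<Sum>k<n+1. T k) = T i + (\<Sum>k\<in>{..<n+1} - {i}. T k)"
      using ij by (intro sum.remove) auto
    also have "(\<Sum>k\<in>{..<n+1} - {i}. T k) =
       (\<Sum>k\<in>{..<n+1} - {i}. of_nat m * (b * q * t * chi m \<alpha> (int c - int r)))"
      using ij True by (intro sum.cong) (auto simp: T sym)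
    also have "\<dots> = of_nat n * (of_nat m * (b * q * t * chi m \<alpha> (int c - int r)))"
      using ij by simp
    finally show ?thesis using True ij by (simp add: T algebra_simps)
  next
    case False
    have "(\<Sum>k<n+1. T k) = T i + (T j + (\<Sum>k\<in>{..<n+1} - {i,j}. T k))"
    proof -
      have "(\<Sum>k<n+1. T k) = T i + (\<Sum>k\<in>{..<n+1} - {i}. T k)"
        using ij by (intro sum.remove) auto
      also have "(\<Sum>k\<in>{..<n+1} - {i}. T k) = T j + (\<Sum>k\<in>{..<n+1} - {i} - {j}. T k)"
        using ij False by (intro sum.remove) auto
      also have "{..<n+1} - {i} - {j} = {..<n+1} - {i,j}" by auto
      finally show ?thesis .
    qed
    also have "(\<Sum>k\<in>{..<n+1} - {i,j}. T k) = (\<Sum>k\<in>{..<n+1} - {i,j}.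
        of_nat m * (b * q * t * chi m \<alpha> (int c - int r)) * chi m \<alpha> (e k j - e i k))"
      by (intro sum.cong) (auto simp: T)
    also have "\<dots> = of_nat m * (b * q * t * chi m \<alpha> (int c - int r)) * (z * (of_nat n - 1))"
      unfolding sum_distrib_left[symmetric] balanced[OF ij False] by (simp add: z_def)
    also have "\<dots> = of_nat m * b * z * (of_nat n - 1) * q * t * chi m \<alpha> (- int r - int c - 1 - e i j)"
      by (simp add: z_def chi_eq_1(2)[OF m])
    finally show ?thesis using False ij by (simp add: T algebra_simps)
  qed
  finally show ?case using rc unfolding a_def[symmetric] b_def[symmetric] z_def[symmetric]
    by (simp add: X_index i_def j_def)
qed simp_all

end

section \<open>Exponents of a BGW matrix over the circulant group\<close>

text \<open>An arbitrary discrete logarithm.  It is determined modulo \<open>m\<close> only, which is all that characters see.\<close>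
definition circ_log :: "nat \<Rightarrow> complex mat \<Rightarrow> nat" where
  "circ_log m g = (SOME k. g = circ_mat m ^\<^sub>m k)"

lemma circ_pow_circ_log:
  assumes "g \<in> carrier (circ_group m)"
  shows "circ_mat m ^\<^sub>m circ_log m g = g"
proof -
  have "\<exists>k. g = circ_mat m ^\<^sub>m k" using assms by (auto simp: circ_group_def)
  from someI_ex[OF this] show ?thesis unfolding circ_log_def by (rule sym)
qed

lemma circ_pow_carrier [simp]: "circ_mat m ^\<^sub>m k \<in> carrier_mat m m"
  by (rule pow_carrier_mat) (simp add: circ_mat_def)

lemma circ_pow_mult_index:
  assumes "m > 0" and B: "B \<in> carrier_mat m m" and xy: "x < m" "y < m"
  shows "(circ_mat m ^\<^sub>m k * B) $$ (x,y) = B $$ ((x + k) mod m, y)"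
proof -
  have "(circ_mat m ^\<^sub>m k * B) $$ (x,y) = (\<Sum>r<m. (circ_mat m ^\<^sub>m k) $$ (x,r) * B $$ (r,y))"
    using B xy pow_mat_dim_square[OF circ_pow_carrier[of m 1]]
    by (simp add: circ_mat_pow[OF assms(1)] scalar_prod_def lessThan_atLeast0)
  also have "\<dots> = (\<Sum>r<m. if r = (x + k) mod m then B $$ (r,y) else 0)"
    using xy by (intro sum.cong) (auto simp: circ_mat_pow[OF assms(1)])
  also have "\<dots> = B $$ ((x + k) mod m, y)" using assms(1) by simp
  finally show ?thesis .
qed

lemma circ_pow_add:
  assumes "m > 0"
  shows "circ_mat m ^\<^sub>m a * circ_mat m ^\<^sub>m b = circ_mat m ^\<^sub>m (a + b)"
proof (rule eq_matI, goal_cases)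
  case (1 x y)
  then have "x < m" "y < m" by (simp_all add: circ_mat_pow[OF assms])
  moreover have "((x + a) mod m + b) mod m = (x + (a + b)) mod m"
    by (simp add: mod_simps add.assoc)
  ultimately show ?case using assms
    by (subst circ_pow_mult_index) (simp_all add: circ_mat_pow[OF assms])
qed (simp_all add: circ_mat_pow[OF assms])

lemma circ_pow_eq_iff:
  assumes "m > 0"
  shows "circ_mat m ^\<^sub>m a = circ_mat m ^\<^sub>m b \<longleftrightarrow> int m dvd int a - int b"
proof -
  have *: "(circ_mat m ^\<^sub>m k) $$ (0, l) = (if l = k mod m then 1 else 0)" if "l < m" for k l
    using that assms by (simp add: circ_mat_pow)
  have "circ_mat m ^\<^sub>m a = circ_mat m ^\<^sub>m b \<longleftrightarrow> a mod m = b mod m"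
  proof
    assume "circ_mat m ^\<^sub>m a = circ_mat m ^\<^sub>m b"
    with *[of "a mod m" a] *[of "a mod m" b] assms show "a mod m = b mod m"
      by (simp split: if_splits)
  next
    assume "a mod m = b mod m"
    then have "(i + a) mod m = (i + b) mod m" for i by (metis mod_add_right_eq)
    then show "circ_mat m ^\<^sub>m a = circ_mat m ^\<^sub>m b" by (simp add: circ_mat_pow[OF assms])
  qed
  also have "\<dots> \<longleftrightarrow> int m dvd int a - int b"
    by (metis mod_eq_dvd_iff of_nat_eq_iff of_nat_mod)
  finally show ?thesis .
qed

lemma sum_circ_group:
  fixes f :: "complex mat \<Rightarrow> 'a::comm_monoid_add"
  assumes "m > 0"
  shows "(\<Sum>g\<in>carrier (circ_group m). f g) = (\<Sum>k<m. f (circ_mat m ^\<^sub>m k))"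
proof -
  have "bij_betw (\<lambda>k. circ_mat m ^\<^sub>m k) {..<m} (carrier (circ_group m))"
  proof (rule bij_betw_imageI)
    show "inj_on (\<lambda>k. circ_mat m ^\<^sub>m k) {..<m}"
    proof (rule inj_onI)
      fix a b assume "a \<in> {..<m}" "b \<in> {..<m}" and eq: "circ_mat m ^\<^sub>m a = circ_mat m ^\<^sub>m b"
      then show "a = b" using circ_pow_eq_iff[OF assms, of a b]
        by (metis lessThan_iff mod_eq_dvd_iff mod_less of_nat_eq_iff of_nat_mod)
    qed
    have "circ_mat m ^\<^sub>m k \<in> (\<lambda>k. circ_mat m ^\<^sub>m k) ` {..<m}" for k
      using circ_pow_eq_iff[OF assms, of k "k mod m"] assms
      by (intro image_eqI[where x = "k mod m"]) (simp_all add: mod_eq_dvd_iff[symmetric] of_nat_mod)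
    then show "(\<lambda>k. circ_mat m ^\<^sub>m k) ` {..<m} = carrier (circ_group m)"
      by (auto simp: circ_group_def)
  qed
  from sum.reindex_bij_betw[OF this, of f] show ?thesis by simp
qed

definition entry_exponent :: "nat \<Rightarrow> complex mat option mat \<Rightarrow> nat \<Rightarrow> nat \<Rightarrow> nat" where
  "entry_exponent m W i j = circ_log m (the (W $$ (i,j)))"

text \<open>A row has \<open>n\<close> nonzero entries among \<open>n + 1\<close>, so a zero diagonal leaves no other zero.\<close>
lemma BGW_entry:
  assumes "is_BGW (circ_group m) (n + 1) n lam W"
    and "\<forall>i<n + 1. W $$ (i,i) = None"
    and "i < n + 1" "j < n + 1" "i \<noteq> j"
  shows "W $$ (i,j) = Some (circ_mat m ^\<^sub>m entry_exponent m W i j)"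
proof -
  let ?S = "{j. j < n + 1 \<and> W $$ (i,j) \<noteq> None}"
  have "card ?S = card ({..<n+1} - {i})" using assms by (simp add: is_BGW_def)
  moreover have "?S \<subseteq> {..<n+1} - {i}" using assms by auto
  ultimately have "?S = {..<n+1} - {i}" by (intro card_subset_eq) auto
  then have nz: "W $$ (i,j) \<noteq> None" using assms(4,5) by auto
  moreover have "W $$ (i,j) \<in> insert None (Some ` carrier (circ_group m))"
    using assms(1,3,4) by (auto simp: is_BGW_def)
  ultimately obtain g where g: "W $$ (i,j) = Some g" "g \<in> carrier (circ_group m)" by auto
  then show ?thesis by (simp add: entry_exponent_def circ_pow_circ_log)
qed

text \<open>Grouping the sum over \<open>k\<close> by the value of \<open>w\<^sub>j\<^sub>k w\<^sub>i\<^sub>k\<^sup>-\<^sup>1\<close>, every group element collects \<open>(n - 1)/m\<close> terms, so a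
  complete character sum is left.  Symmetry of \<open>W\<close> turns \<open>w\<^sub>j\<^sub>k\<close> into \<open>w\<^sub>k\<^sub>j\<close>.\<close>
lemma BGW_balanced_exponents:
  assumes n: "n > 0" and m: "m > 0"
    and W: "is_BGW (circ_group m) (n + 1) n (n - 1) W"
    and sym: "\<forall>i<n + 1. \<forall>j<n + 1. W $$ (i,j) = W $$ (j,i)"
    and diag: "\<forall>i<n + 1. W $$ (i,i) = None"
  shows "balanced_exponents n m (\<lambda>i j. int (entry_exponent m W i j))"
proof
  let ?e = "entry_exponent m W"
  let ?G = "circ_group m"
  interpret G: group ?G by (rule circ_group_finite_group[OF m])
  fix i j :: nat and \<alpha> :: int
  assume ij: "i < n + 1" "j < n + 1" "i \<noteq> j"
  let ?K = "{..<n + 1} - {i,j}"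
  define g where "g k = the (W $$ (j,k)) \<otimes>\<^bsub>?G\<^esub> inv\<^bsub>?G\<^esub> the (W $$ (i,k))" for k
  have "{k. k < n + 1 \<and> W $$ (j,k) \<noteq> None \<and> W $$ (i,k) \<noteq> None} = ?K"
    using BGW_entry[OF W diag ij(1)] BGW_entry[OF W diag ij(2)] diag ij
    by auto
  note K = this
  have cnt: "real (count (image_mset g (mset_set ?K)) h) = real (n - 1) / real m"
    if h: "h \<in> carrier ?G" for h
  proof -
    have "\<forall>i<n + 1. \<forall>h<n + 1. i \<noteq> h \<longrightarrow> (\<forall>g\<in>carrier ?G.
        real (count {# the (W $$ (i,k)) \<otimes>\<^bsub>?G\<^esub> inv\<^bsub>?G\<^esub> the (W $$ (h,k)).
          k \<in># mset_set {k. k < n + 1 \<and> W $$ (i,k) \<noteq> None \<and> W $$ (h,k) \<noteq> None} #} g)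
        = real (n - 1) / real (order ?G))"
      using W unfolding is_BGW_def by (elim conjE)
    from this[rule_format, OF ij(2) ij(1) ij(3)[symmetric] h] show ?thesis
      unfolding K g_def circ_group_finite_group(3)[OF m] .
  qed
  define f where "f h = chi m \<alpha> (int (circ_log m h))" for h
  have g: "g k \<in> carrier ?G \<and> f (g k) = chi m \<alpha> (int (?e k j) - int (?e i k))" if k: "k \<in> ?K" for k
  proof -
    have wj: "W $$ (j,k) = Some (circ_mat m ^\<^sub>m ?e j k)" and wi: "W $$ (i,k) = Some (circ_mat m ^\<^sub>m ?e i k)"
      using k ij by (auto intro!: BGW_entry[OF W diag])
    have c: "circ_mat m ^\<^sub>m l \<in> carrier ?G" for l by (simp add: circ_group_def)
    then have gk: "g k \<in> carrier ?G" by (simp add: g_def wj wi)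
    have "g k \<otimes>\<^bsub>?G\<^esub> circ_mat m ^\<^sub>m ?e i k = circ_mat m ^\<^sub>m ?e j k"
      by (simp add: g_def wj wi G.m_assoc c)
    then have "circ_mat m ^\<^sub>m (circ_log m (g k) + ?e i k) = circ_mat m ^\<^sub>m ?e j k"
      unfolding circ_pow_add[OF m, symmetric] circ_pow_circ_log[OF gk] by (simp add: circ_group_def)
    then have "int m dvd int (circ_log m (g k)) - (int (?e j k) - int (?e i k))"
      unfolding circ_pow_eq_iff[OF m] by (simp add: algebra_simps)
    then have "f (g k) = chi m \<alpha> (int (?e j k) - int (?e i k))"
      unfolding f_def by (rule chi_cong[OF m])
    moreover have "?e j k = ?e k j" using sym k ij by (simp add: entry_exponent_def)
    ultimately show ?thesis using gk by simp
  qed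
  have "(\<Sum>k\<in>?K. chi m \<alpha> (int (?e k j) - int (?e i k))) = (\<Sum>k\<in>?K. f (g k))"
    using g by (intro sum.cong) auto
  also have "\<dots> = (\<Sum>h\<in>carrier ?G. \<Sum>k\<in>{k\<in>?K. g k = h}. f (g k))"
    using g circ_group_finite_group(2)[OF m] by (intro sum.group[symmetric]) auto
  also have "\<dots> = (\<Sum>h\<in>carrier ?G. of_nat (n - 1) / of_nat m * f h)"
  proof (rule sum.cong[OF refl])
    fix h assume h: "h \<in> carrier ?G"
    have "(\<Sum>k\<in>{k\<in>?K. g k = h}. f (g k)) = of_nat (card {k\<in>?K. g k = h}) * f h" by simp
    also have "card {k\<in>?K. g k = h} = count (image_mset g (mset_set ?K)) h"
      by (simp add: count_image_mset Int_def vimage_def conj_commute)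
    also have "(of_nat (count (image_mset g (mset_set ?K)) h) :: complex)
        = complex_of_real (real (count (image_mset g (mset_set ?K)) h))" by simp
    also have "\<dots> = of_nat (n - 1) / of_nat m" unfolding cnt[OF h] by simp
    finally show "(\<Sum>k\<in>{k\<in>?K. g k = h}. f (g k)) = of_nat (n - 1) / of_nat m * f h" .
  qed
  also have "\<dots> = of_nat (n - 1) / of_nat m * (\<Sum>k<m. f (circ_mat m ^\<^sub>m k))"
    by (simp only: sum_circ_group[OF m] sum_distrib_left[symmetric])
  also have "(\<Sum>k<m. f (circ_mat m ^\<^sub>m k)) = (\<Sum>k<m. chi m \<alpha> (int k))"
    unfolding f_def
    by (intro sum.cong refl chi_cong[OF m] iffD1[OF circ_pow_eq_iff[OF m]] circ_pow_circ_log)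
       (simp add: circ_group_def)
  finally show "(\<Sum>k\<in>?K. chi m \<alpha> (int (?e k j) - int (?e i k))) = (if int m dvd \<alpha> then of_nat n - 1 else 0)"
    using m n by (simp add: sum_chi of_nat_diff)
qed (use n m sym in \<open>simp_all add: entry_exponent_def\<close>)

section \<open>Fourier transform of the adjacency matrices\<close>

lemma backdiag_carrier: "backdiag_mat m \<in> carrier_mat m m"
  by (simp add: backdiag_mat_def)

text \<open>The condition \<open>x + y + 1 = m\<close> on the anti-diagonal is a congruence modulo \<open>m\<close>, since \<open>x + y + 1\<close> lies
  strictly between \<open>0\<close> and \<open>2 m\<close>.  This is what makes the blocks of the adjacency matrices periodic.\<close>
lemma backdiag_index:
  assumes "x < m" "y < m"
  shows "backdiag_mat m $$ (s mod m, y) = of_bool (int m dvd int s + int y + 1)"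
proof -
  have "s mod m + y + 1 = m \<longleftrightarrow> m dvd s mod m + y + 1"
  proof
    assume "m dvd s mod m + y + 1"
    then obtain q where q: "s mod m + y + 1 = m * q" by (elim dvdE)
    have "s mod m < m" using assms by simp
    with q assms(2) have "m * q < m * 2" "m * q > 0" by linarith+
    then have "q = 1" by simp
    with q show "s mod m + y + 1 = m" by simp
  qed simp
  also have "\<dots> \<longleftrightarrow> (s mod m + y + 1) mod m = 0" by (simp add: dvd_eq_mod_eq_0)
  also have "\<dots> \<longleftrightarrow> m dvd s + y + 1"
    by (metis dvd_eq_mod_eq_0 mod_add_left_eq)
  also have "\<dots> \<longleftrightarrow> int m dvd int s + int y + 1"
    by (metis of_nat_1 of_nat_add of_nat_dvd_iff)
  finally show ?thesis using assms by (simp add: backdiag_mat_def)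
qed

locale bgw_scheme = balanced_exponents +
  fixes W :: "complex mat option mat"
  assumes W_entry: "\<And>i j. i < n + 1 \<Longrightarrow> j < n + 1 \<Longrightarrow> i \<noteq> j \<Longrightarrow>
      \<exists>k. e i j = int k \<and> W $$ (i,j) = Some (circ_mat m ^\<^sub>m k)"
begin

abbreviation A where "A \<equiv> A_mat n m W"
abbreviation F where "F \<equiv> F_mat n m W"

lemma N_pos [simp]: "N > 0"
  using m by (simp add: N_def)

lemma F_finsum: "F \<alpha> i = finsum (module_mat TYPE(complex) N N) (\<lambda>\<gamma>. chi m \<alpha> (int \<gamma>) \<cdot>\<^sub>m A \<gamma> i) {..<m}"
  by (simp only: F_mat_def N_def)

lemma A_carrier [simp]: "A l i \<in> carrier_mat N N"
proof -
  have "dim_row (circ_mat m ^\<^sub>m l) = m" "dim_col (circ_mat m ^\<^sub>m l) = m"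
    using circ_pow_carrier[of m l] by (simp_all only: carrier_matD)
  then show ?thesis
    unfolding A_mat_def N_mat_def block_mat_def kron_mat_def allones_mat_def N_def
    by (intro carrier_matI) simp_all
qed

lemma A0_index:
  assumes rc: "r < N" "c < N"
  shows "A l 0 $$ (r,c) = (if r div m = c div m then of_bool (int m dvd int l - (int c - int r)) else 0)"
proof -
  have "r div m < n + 1" "c div m < n + 1" using rc by (simp_all only: block_index)
  moreover have "c mod m = (r mod m + l) mod m \<longleftrightarrow> int m dvd int l - (int c - int r)"
  proof -
    have "c mod m = (r mod m + l) mod m \<longleftrightarrow> int c mod int m = int (r + l) mod int m"
      by (metis mod_add_left_eq of_nat_eq_iff of_nat_mod)
    also have "\<dots> \<longleftrightarrow> int m dvd int (r + l) - int c" by (metis mod_eq_dvd_iff)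
    finally show ?thesis by (simp add: algebra_simps)
  qed
  ultimately show ?thesis using rc m unfolding N_def
    by (auto simp: A_mat_def kron_mat_def circ_mat_pow[OF m])
qed

lemma A1_index:
  assumes rc: "r < N" "c < N"
  shows "A l 1 $$ (r,c) = (if r div m = c div m then 0
    else of_bool (int m dvd int l - (- int r - int c - 1 - e (r div m) (c div m))))"
proof -
  define i j x y where "i = r div m" and "j = c div m" and "x = r mod m" and "y = c mod m"
  have ij: "i < n + 1" "j < n + 1" using rc by (simp_all only: i_def j_def block_index)
  have xy: "x < m" "y < m" using m by (simp_all add: x_def y_def)
  have entry: "A l 1 $$ (r,c) = (if i = j then 0
      else (entry_mat m (W $$ (i,j)) * circ_mat m ^\<^sub>m l * backdiag_mat m) $$ (x,y))"
    using rc ij xy unfolding N_def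
    by (simp add: A_mat_def N_mat_def kron_mat_def block_mat_def allones_mat_def
        i_def[symmetric] j_def[symmetric] x_def[symmetric] y_def[symmetric])
  show ?thesis
  proof (cases "i = j")
    case False
    obtain k where k: "e i j = int k" "W $$ (i,j) = Some (circ_mat m ^\<^sub>m k)"
      using W_entry[OF ij False] by auto
    have "A l 1 $$ (r,c) = (circ_mat m ^\<^sub>m (k + l) * backdiag_mat m) $$ (x,y)"
      unfolding entry k(2) using False by (simp add: entry_mat_def circ_pow_add[OF m])
    also have "\<dots> = of_bool (int m dvd int (x + (k + l)) + int y + 1)"
      unfolding circ_pow_mult_index[OF m backdiag_carrier xy] by (rule backdiag_index[OF xy])
    also have "int m dvd int (x + (k + l)) + int y + 1 \<longleftrightarrow>
        int m dvd int l - (- int r - int c - 1 - e i j)"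
    proof -
      have "int r = int m * int i + int x" "int c = int m * int j + int y"
        by (simp_all add: i_def j_def x_def y_def flip: of_nat_mult of_nat_add)
      then have eq: "int l - (- int r - int c - 1 - e i j) =
          (int (x + (k + l)) + int y + 1) + int m * (int i + int j)"
        by (simp add: k algebra_simps)
      show ?thesis unfolding eq dvd_add_left_iff[OF dvd_triv_left] ..
    qed
    finally show ?thesis using False by (simp add: i_def j_def)
  next
    case True
    then show ?thesis unfolding entry by (simp add: i_def j_def)
  qed
qed

lemma A_index:
  assumes "r < N" "c < N" "i \<in> {0,1}"
  shows "A l i $$ (r,c) = (if r div m = c div m
    then of_bool (i = 0) * of_bool (int m dvd int l - (int c - int r))
    else of_bool (i = 1) * of_bool (int m dvd int l - (- int r - int c - 1 - e (r div m) (c div m))))"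
  using assms A0_index[OF assms(1,2)] A1_index[OF assms(1,2), unfolded One_nat_def] by auto

text \<open>Summing over the index of the adjacency matrices leaves, in each position, a single character value.\<close>
lemma F_eq_X:
  assumes i: "i \<in> {0,1}"
  shows "F \<alpha> i = X \<alpha> (of_bool (i = 0)) (of_bool (i = 1))"
proof (rule eq_matI, unfold X_dims, goal_cases)
  case (1 r c)
  have "F \<alpha> i $$ (r,c) = (\<Sum>\<gamma><m. (chi m \<alpha> (int \<gamma>) \<cdot>\<^sub>m A \<gamma> i) $$ (r,c))"
    unfolding F_finsum using 1 by (intro finsum_mat_index) (auto simp: A_carrier)
  also have "\<dots> = (\<Sum>\<gamma><m. chi m \<alpha> (int \<gamma>) * A \<gamma> i $$ (r,c))"
    using 1 A_carrier by (intro sum.cong refl index_smult_mat(1)) (auto simp: A_carrier[THEN carrier_matD(1)] A_carrier[THEN carrier_matD(2)])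
  also have "\<dots> = X \<alpha> (of_bool (i = 0)) (of_bool (i = 1)) $$ (r,c)"
    using fourier_delta[OF m, of \<alpha>] i
    by (auto simp: A_index[OF 1 i] X_index[OF 1])
  finally show ?case .
next
  case 2
  show ?case using finsum_mat_carrier[of "{..<m}" "\<lambda>\<gamma>. chi m \<alpha> (int \<gamma>) \<cdot>\<^sub>m A \<gamma> i" N]
    by (simp add: F_finsum)
next
  case 3
  show ?case using finsum_mat_carrier[of "{..<m}" "\<lambda>\<gamma>. chi m \<alpha> (int \<gamma>) \<cdot>\<^sub>m A \<gamma> i" N]
    by (simp add: F_finsum)
qed

text \<open>The orthogonality relation \<open>\<Sum>\<^sub>\<alpha> \<chi>\<^sub>\<alpha>(k - l) = m \<delta>\<^sub>k\<^sub>l\<close> undoes the Fourier transform.\<close>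
lemma A_fourier_inversion:
  assumes i: "i \<in> {0,1}"
  shows "A l i = finsum (module_mat TYPE(complex) N N)
    (\<lambda>a. (chi m (int a) (- int l) / of_nat m) \<cdot>\<^sub>m X (int a) (of_bool (i = 0)) (of_bool (i = 1))) {..<m}"
    (is "_ = finsum _ ?f _")
proof (rule eq_matI)
  have fc: "finsum (module_mat TYPE(complex) N N) ?f {..<m} \<in> carrier_mat N N"
    by (intro finsum_mat_carrier) auto
  show "dim_row (A l i) = dim_row (finsum (module_mat TYPE(complex) N N) ?f {..<m})"
    "dim_col (A l i) = dim_col (finsum (module_mat TYPE(complex) N N) ?f {..<m})"
    by (simp_all only: carrier_matD[OF fc] carrier_matD[OF A_carrier])
  fix r c
  assume "r < dim_row (finsum (module_mat TYPE(complex) N N) ?f {..<m})"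
    "c < dim_col (finsum (module_mat TYPE(complex) N N) ?f {..<m})"
  then have rc: "r < N" "c < N" by (simp_all only: carrier_matD[OF fc])
  have inv: "(\<Sum>a<m. chi m (int a) (- int l) / of_nat m * chi m (int a) k) = of_bool (int m dvd int l - k)" for k
  proof -
    have "(\<Sum>a<m. chi m (int a) (- int l) / of_nat m * chi m (int a) k) =
        (\<Sum>a<m. chi m (k - int l) (int a)) / of_nat m"
      unfolding sum_divide_distrib
    proof (intro sum.cong refl)
      fix a
      show "chi m (int a) (- int l) / of_nat m * chi m (int a) k = chi m (k - int l) (int a) / of_nat m"
        using chi_add[of m "int a" "- int l" k] chi_commute[of m "k - int l" "int a"] by simp
    qed
    also have "\<dots> = of_bool (int m dvd int l - k)"
      using m by (simp add: sum_chi dvd_diff_commute)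
    finally show ?thesis .
  qed
  have "finsum (module_mat TYPE(complex) N N) ?f {..<m} $$ (r,c) = (\<Sum>a<m. ?f a $$ (r,c))"
    using rc by (intro finsum_mat_index) auto
  also have "\<dots> = A l i $$ (r,c)"
    using i rc inv by (auto simp: A_index[OF rc i] X_index[OF rc] mult.assoc[symmetric])
  finally show "A l i $$ (r,c) = finsum (module_mat TYPE(complex) N N) ?f {..<m} $$ (r,c)" ..
qed

lemma X_in_span_A:
  "X \<alpha> p q \<in> adjacency_algebra N {A l i | l i. l < m \<and> i \<in> {0,1}}" (is "_ \<in> adjacency_algebra N ?S")
proof -
  have S: "?S \<subseteq> carrier_mat N N" using A_carrier by auto
  have F: "F \<alpha> i \<in> adjacency_algebra N ?S" if "i \<in> {0,1}" for i
    unfolding F_finsum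
  proof (rule finsum_mat_in_adjacency_algebra[OF _ _ S])
    fix \<gamma> assume "\<gamma> \<in> {..<m}"
    then have "A \<gamma> i \<in> ?S" using that by auto
    then show "chi m \<alpha> (int \<gamma>) \<cdot>\<^sub>m A \<gamma> i \<in> adjacency_algebra N ?S"
      by (intro adjacency_algebra_smult[OF S] adjacency_algebra_base[OF S])
  qed (auto simp: A_carrier)
  have X: "X \<alpha> p q = p \<cdot>\<^sub>m F \<alpha> 0 + q \<cdot>\<^sub>m F \<alpha> 1"
    by (simp add: F_eq_X X_smult X_add)
  show ?thesis unfolding X
    by (intro adjacency_algebra_add[OF S] adjacency_algebra_smult[OF S] F) auto
qed

section \<open>The components of the decomposition\<close>

abbreviation sqrt_n :: complex where "sqrt_n \<equiv> of_real (sqrt (real n))"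

lemma sqrt_n: "sqrt_n \<noteq> 0" "sqrt_n * sqrt_n = of_nat n"
proof -
  show "sqrt_n \<noteq> 0" using n by simp
  show "sqrt_n * sqrt_n = of_nat n" unfolding of_real_mult[symmetric] by simp
qed

lemma sqrt_n_quotient: "sqrt_n * b = a \<Longrightarrow> of_nat n * b * b = a * a"
  unfolding sqrt_n(2)[symmetric] by (auto simp only: mult_ac)

abbreviation E where "E \<equiv> E_one n m W"
abbreviation D where "D \<equiv> E_two n m W"

text \<open>Of the scalar \<open>a = 1/((n+1) m)\<close> only its defining equation matters; keeping it opaque reduces later
  identities between coefficients to polynomial identities.  The same holds for the next two lemmas.\<close>
lemma E01_eq_X:
  obtains a where "of_nat m * (of_nat n + 1) * a = 1" "cnj a = a"
    "E 0 = X 0 a a" "E 1 = X 0 (of_nat n * a) (- a)"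
proof
  let ?a = "1 / of_nat N :: complex"
  have "of_nat N * ?a = 1" using N_pos by simp
  then show "of_nat m * (of_nat n + 1) * ?a = 1" by (simp add: N_def algebra_simps)
  have "E 0 = ?a \<cdot>\<^sub>m allones_mat N" unfolding E_one_def N_def by simp
  then show "E 0 = X 0 ?a ?a" by (intro eq_matI) (simp_all add: allones_mat_def X_index)
  show "E 1 = X 0 (of_nat n * ?a) (- ?a)"
    by (simp add: E_one_def F_eq_X X_smult X_diff N_def)
qed simp

lemma E23_eq_X:
  obtains a b where "2 * of_nat m * a = 1" "sqrt_n * b = a" "cnj a = a" "cnj b = b"
    "E 2 = X (int m div 2) a b" "E 3 = X (int m div 2) a (- b)"
proof
  let ?a = "1 / (2 * of_nat m) :: complex" and ?b = "1 / (2 * of_nat m * sqrt_n)"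
  show "2 * of_nat m * ?a = 1" "sqrt_n * ?b = ?a" using m sqrt_n(1) by simp_all
  show "E 2 = X (int m div 2) ?a ?b" "E 3 = X (int m div 2) ?a (- ?b)"
    by (simp_all add: E_one_def F_eq_X X_smult X_add X_diff)
qed simp_all

lemma D_eq_X:
  obtains a b where "of_nat m * a = 1" "sqrt_n * b = a" "cnj a = a" "cnj b = b"
    "\<forall>\<alpha>. \<forall>j\<in>{1,2}. \<forall>k\<in>{1,2}.
      D \<alpha> j k = X (if j = 1 then \<alpha> else - \<alpha>) (if j = k then a else 0) (if j = k then 0 else b)"
proof
  let ?a = "1 / of_nat m :: complex" and ?b = "1 / (of_nat m * sqrt_n)"
  show "of_nat m * ?a = 1" "sqrt_n * ?b = ?a" using m sqrt_n(1) by simp_all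
  show "\<forall>\<alpha>. \<forall>j\<in>{1,2}. \<forall>k\<in>{1,2}.
      D \<alpha> j k = X (if j = 1 then \<alpha> else - \<alpha>) (if j = k then ?a else 0) (if j = k then 0 else ?b)"
    by (auto simp: E_two_def F_eq_X X_smult)
qed simp_all

text \<open>Within a class that equals its own negative, both kinds of products survive and the algebra is
  commutative; it is two-dimensional and splits into the two idempotents.\<close>
lemma X_mult_paired:
  assumes "int m dvd 2 * \<alpha>"
  shows "X \<alpha> p q * X \<alpha> s t = X \<alpha> (of_nat m * (p * s + of_nat n * q * t))
     (of_nat m * (p * t + q * s + of_bool (int m dvd \<alpha>) * (of_nat n - 1) * q * t))"
proof -
  have "int m dvd \<alpha> + \<alpha>" using assms by (simp only: mult_2)
  then show ?thesis unfolding X_mult Let_def by simp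
qed

lemma X_mult_disjoint:
  assumes "\<not> int m dvd \<alpha> - \<beta>" "\<not> int m dvd \<alpha> + \<beta>"
  shows "X \<alpha> p q * X \<beta> s t = 0\<^sub>m N N"
  using assms unfolding X_mult Let_def by (simp add: X_zero)

text \<open>Conjugation inverts characters, and so does transposition of a diagonal block, because its entries
  depend on \<open>y - x\<close>.  Off-diagonal blocks are symmetric, so there \<open>\<alpha>\<close> becomes \<open>-\<alpha>\<close>: harmless if the two
  agree or if there is no such part, and otherwise the statement of \<open>X_adjoint_anti\<close>.\<close>
lemma X_adjoint:
  assumes "int m dvd 2 * \<alpha> \<or> q = 0"
  shows "mat_adjoint (X \<alpha> p q) = X \<alpha> (cnj p) (cnj q)"
proof (rule eq_matI, unfold X_dims, goal_cases)
  case (1 r c)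
  have ij: "r div m < n + 1" "c div m < n + 1" using 1 by (simp_all only: block_index)
  have "mat_adjoint (X \<alpha> p q) $$ (r,c) = cnj (X \<alpha> p q $$ (c,r))"
    using 1 by (simp add: mat_adjoint_def mat_of_rows_def)
  also have "\<dots> = X \<alpha> (cnj p) (cnj q) $$ (r,c)"
    using assms 1 sym[OF ij]
      chi_cong_char[OF m, of \<alpha> "-\<alpha>" "- int r - int c - 1 - e (r div m) (c div m)"]
    by (auto simp: X_index cnj_chi chi_minus_char algebra_simps)
  finally show ?case .
qed (simp_all add: mat_adjoint_def)

lemma X_adjoint_anti: "mat_adjoint (X \<alpha> 0 q) = X (-\<alpha>) 0 (cnj q)"
proof (rule eq_matI, unfold X_dims, goal_cases)
  case (1 r c)
  have ij: "r div m < n + 1" "c div m < n + 1" using 1 by (simp_all only: block_index)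
  have "mat_adjoint (X \<alpha> 0 q) $$ (r,c) = cnj (X \<alpha> 0 q $$ (c,r))"
    using 1 by (simp add: mat_adjoint_def mat_of_rows_def)
  also have "\<dots> = X (-\<alpha>) 0 (cnj q) $$ (r,c)"
    using 1 sym[OF ij]
    by (auto simp: X_index cnj_chi chi_minus_char algebra_simps)
  finally show ?case .
qed (simp_all add: mat_adjoint_def)

definition one_dim_index :: "nat set" where "one_dim_index = (if even m then {0,1,2,3} else {0,1})"

text \<open>For even \<open>m\<close>, \<open>(m - 1) div 2 = m div 2 - 1\<close>, so one expression for the two-dimensional indices serves both
  parities.\<close>
definition two_dim_index :: "int set" where "two_dim_index = {1..(int m - 1) div 2}"

lemma two_dim_index_iff: "\<alpha> \<in> two_dim_index \<longleftrightarrow> 0 < \<alpha> \<and> 2 * \<alpha> < int m"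
  by (auto simp: two_dim_index_def)

lemma dvd_small: "int m dvd a \<Longrightarrow> \<bar>a\<bar> < int m \<Longrightarrow> a = 0"
  using dvd_imp_le_int[of a "int m"] by auto

text \<open>For even \<open>m\<close> the class of \<open>m/2\<close> equals its own negative but is not trivial.\<close>
lemma half_dvd: "even m \<Longrightarrow> int m dvd int m div 2 + int m div 2" "even m \<Longrightarrow> int m dvd 2 * (int m div 2)"
   "even m \<Longrightarrow> \<not> int m dvd int m div 2"
proof -
  assume ev: "even m"
  then show "int m dvd int m div 2 + int m div 2" "int m dvd 2 * (int m div 2)" by auto
  show "\<not> int m dvd int m div 2" using dvd_small[of "int m div 2"] m ev by auto
qed

text \<open>What the one-dimensional components have in common: real coefficients, a class equal to its own
  negative, and hence a class that differs from those of the two-dimensional components and from their negatives.\<close>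
lemma E_X_data:
  assumes "i \<in> one_dim_index"
  obtains \<alpha> p q where "E i = X \<alpha> p q" "int m dvd 2 * \<alpha>" "p \<noteq> 0" "cnj p = p" "cnj q = q"
    "\<forall>\<beta>\<in>two_dim_index. \<not> int m dvd \<alpha> - \<beta> \<and> \<not> int m dvd \<alpha> + \<beta>"
proof -
  have z: "\<not> int m dvd 0 - \<beta> \<and> \<not> int m dvd 0 + \<beta>" if "\<beta> \<in> two_dim_index" for \<beta>
    using that dvd_small[of \<beta>] by (auto simp: two_dim_index_iff)
  have h: "\<not> int m dvd int m div 2 - \<beta> \<and> \<not> int m dvd int m div 2 + \<beta>" if "even m" "\<beta> \<in> two_dim_index" for \<beta>
    using that dvd_small[of "int m div 2 - \<beta>"] dvd_small[of "int m div 2 + \<beta>"] m by (auto simp: two_dim_index_iff)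
  obtain a where a: "of_nat m * (of_nat n + 1) * a = 1" "cnj a = a"
    "E 0 = X 0 a a" "E 1 = X 0 (of_nat n * a) (- a)" by (rule E01_eq_X)
  obtain c b where c: "2 * of_nat m * c = 1" "sqrt_n * b = c" "cnj c = c" "cnj b = b"
    "E 2 = X (int m div 2) c b" "E 3 = X (int m div 2) c (- b)" by (rule E23_eq_X)
  have nz: "a \<noteq> 0" "of_nat n * a \<noteq> 0" "c \<noteq> 0" using a(1) c(1) n by auto
  consider "i = 0" | "i = 1" | "i = 2" "even m" | "i = 3" "even m"
    using assms by (auto simp: one_dim_index_def split: if_splits)
  then show ?thesis
  proof cases
    case 1
    show ?thesis by (rule that[of 0 a a]) (use 1 a nz z in simp_all)
  next
    case 2
    show ?thesis unfolding 2 by (rule that[of 0 "of_nat n * a" "- a", unfolded 2, OF a(4)]) (use a nz z in simp_all)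
  next
    case 3
    show ?thesis by (rule that[of "int m div 2" c b]) (use 3 c nz h half_dvd(2) in simp_all)
  next
    case 4
    show ?thesis by (rule that[of "int m div 2" c "- b"]) (use 4 c nz h half_dvd(2) in simp_all)
  qed
qed

text \<open>Two components with the same class reduce to polynomial identities in the coefficients; the classes
  \<open>0\<close> and \<open>m/2\<close> are orthogonal.\<close>
lemma E_mult:
  assumes "i \<in> one_dim_index" "i' \<in> one_dim_index"
  shows "E i * E i' = (if i = i' then E i else 0\<^sub>m N N)"
proof -
  have zero: "E 0 * E 0 = E 0" "E 0 * E 1 = 0\<^sub>m N N" "E 1 * E 0 = 0\<^sub>m N N" "E 1 * E 1 = E 1"
  proof -
    obtain a where a: "of_nat m * (of_nat n + 1) * a = 1"
      and E0: "E 0 = X 0 a a" and E1: "E 1 = X 0 (of_nat n * a) (- a)" by (rule E01_eq_X)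
    have M: "X 0 p q * X 0 s t = X 0 (of_nat m * (p * s + of_nat n * q * t))
       (of_nat m * (p * t + q * s + (of_nat n - 1) * q * t))" for p q s t
      by (simp add: X_mult_paired)
    show "E 0 * E 0 = E 0" unfolding E0 M
      by (intro arg_cong2[of _ _ _ _ "X 0"]; use a in Groebner_Basis.algebra)
    show "E 0 * E 1 = 0\<^sub>m N N"
      unfolding E0 E1 M X_zero[of 0, symmetric]
      by (intro arg_cong2[of _ _ _ _ "X 0"]; simp add: algebra_simps)
    show "E 1 * E 0 = 0\<^sub>m N N"
      unfolding E0 E1 M X_zero[of 0, symmetric]
      by (intro arg_cong2[of _ _ _ _ "X 0"]; simp add: algebra_simps)
    show "E 1 * E 1 = E 1" unfolding E1 M
      by (intro arg_cong2[of _ _ _ _ "X 0"]; use a in Groebner_Basis.algebra)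
  qed
  have half: "E 2 * E 2 = E 2" "E 2 * E 3 = 0\<^sub>m N N" "E 3 * E 2 = 0\<^sub>m N N" "E 3 * E 3 = E 3"
    if "even m"
  proof -
    let ?h = "int m div 2"
    obtain a b where a: "2 * of_nat m * a = 1" and sb: "sqrt_n * b = a"
      and E2: "E 2 = X ?h a b" and E3: "E 3 = X ?h a (- b)" by (rule E23_eq_X)
    have M: "X ?h p q * X ?h s t = X ?h (of_nat m * (p * s + of_nat n * q * t))
       (of_nat m * (p * t + q * s))" for p q s t
      using that by (simp add: X_mult_paired half_dvd)
    have b: "of_nat n * b * b = a * a" using sb by (rule sqrt_n_quotient)
    show "E 2 * E 2 = E 2" unfolding E2 M
      by (intro arg_cong2[of _ _ _ _ "X ?h"]; use a b in Groebner_Basis.algebra)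
    show "E 2 * E 3 = 0\<^sub>m N N"
      unfolding E2 E3 M X_zero[of ?h, symmetric]
      by (intro arg_cong2[of _ _ _ _ "X ?h"]; use b in \<open>simp add: mult.assoc\<close>)
    show "E 3 * E 2 = 0\<^sub>m N N"
      unfolding E2 E3 M X_zero[of ?h, symmetric]
      by (intro arg_cong2[of _ _ _ _ "X ?h"]; use b in \<open>simp add: mult.assoc\<close>)
    show "E 3 * E 3 = E 3" unfolding E3 M
      by (intro arg_cong2[of _ _ _ _ "X ?h"]; use a b in Groebner_Basis.algebra)
  qed
  have mixed: "E i * E i' = 0\<^sub>m N N" "E i' * E i = 0\<^sub>m N N"
    if ev: "even m" and i: "i \<in> {0,1}" and i': "i' \<in> {2,3}" for i i'
  proof -
    have "\<exists>p q. E i = X 0 p q" by (rule E01_eq_X) (use i in auto)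
    moreover have "\<exists>s t. E i' = X (int m div 2) s t" by (rule E23_eq_X) (use i' in auto)
    ultimately obtain p q s t where "E i = X 0 p q" "E i' = X (int m div 2) s t" by blast
    then show "E i * E i' = 0\<^sub>m N N" "E i' * E i = 0\<^sub>m N N"
      using half_dvd(3)[OF ev] by (simp_all add: X_mult_disjoint)
  qed
  show ?thesis
  proof (cases "even m")
    case True
    then have "i \<in> {0,1,2,3}" "i' \<in> {0,1,2,3}" using assms by (simp_all add: one_dim_index_def)
    then show ?thesis
      using zero[unfolded One_nat_def] half[OF True] mixed[OF True, of 0] mixed[OF True, of "Suc 0"]
      by (elim insertE emptyE) simp_all
  next
    case False
    then have "i \<in> {0,1}" "i' \<in> {0,1}" using assms by (simp_all add: one_dim_index_def)
    then show ?thesis using zero[unfolded One_nat_def] by (elim insertE emptyE) simp_all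
  qed
qed

text \<open>The row index \<open>j\<close> selects the sign of the class of \<open>D \<alpha> j k\<close>, and \<open>F\<^sub>\<plusminus>\<^sub>\<alpha>\<^sub>,\<^sub>0\<close> or \<open>F\<^sub>\<plusminus>\<^sub>\<alpha>\<^sub>,\<^sub>1\<close> occurs according to
  whether the column index agrees with it.  Since \<open>F\<^sub>\<alpha>\<^sub>,\<^sub>1\<close> is matched by the class \<open>-\<alpha>\<close>, the matching
  condition for two components is exactly \<open>k = j'\<close>.\<close>
lemma D_mult:
  assumes "\<alpha> \<in> two_dim_index" "\<beta> \<in> two_dim_index" "j \<in> {1,2}" "k \<in> {1,2}" "j' \<in> {1,2}" "k' \<in> {1,2}"
  shows "D \<alpha> j k * D \<beta> j' k' = (if \<alpha> = \<beta> \<and> k = j' then D \<alpha> j k' else 0\<^sub>m N N)"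
proof -
  have 1: "int m dvd \<alpha> - \<beta> \<longleftrightarrow> \<alpha> = \<beta>" "int m dvd \<beta> - \<alpha> \<longleftrightarrow> \<alpha> = \<beta>"
    using assms(1,2) dvd_small[of "\<alpha> - \<beta>"] dvd_small[of "\<beta> - \<alpha>"] by (auto simp: two_dim_index_iff)
  have 2: "\<not> int m dvd \<alpha> + \<beta>" "\<not> int m dvd - \<alpha> - \<beta>" "\<not> int m dvd \<alpha>"
    using assms(1,2) dvd_small[of "\<alpha> + \<beta>"] dvd_small[of "- \<alpha> - \<beta>"] dvd_small[of \<alpha>]
    by (auto simp: two_dim_index_iff)
  \<comment> \<open>the class of a component, depending on its row index\<close>
  define sg :: "int \<Rightarrow> nat \<Rightarrow> int" where "sg \<gamma> i = (if i = 1 then \<gamma> else - \<gamma>)" for \<gamma> i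
  have "int m dvd - \<alpha> + \<beta> \<longleftrightarrow> \<alpha> = \<beta>" using 1(2) by simp
  then have sg: "int m dvd sg \<alpha> j - sg \<beta> j' \<longleftrightarrow> \<alpha> = \<beta> \<and> j = j'"
    "int m dvd sg \<alpha> j + sg \<beta> j' \<longleftrightarrow> \<alpha> = \<beta> \<and> j \<noteq> j'" "\<not> int m dvd sg \<alpha> j"
    using assms(3,5) 1 2 by (auto simp: sg_def)
  obtain a b where ma: "of_nat m * a = 1" and sb: "sqrt_n * b = a" and D_X':
    "\<forall>\<alpha>. \<forall>j\<in>{1,2}. \<forall>k\<in>{1,2}.
      D \<alpha> j k = X (if j = 1 then \<alpha> else - \<alpha>) (if j = k then a else 0) (if j = k then 0 else b)"
    by (rule D_eq_X)
  note D_X = D_X'[rule_format]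
  have a: "of_nat m * (a * x) = x" for x using ma by (simp add: mult.assoc[symmetric])
  have ba: "of_nat m * (b * a) = b" using a[of b] by (simp add: mult_ac)
  have bb: "of_nat m * (of_nat n * (b * b)) = a"
    using sqrt_n_quotient[OF sb] a[of a] by (simp only: mult.assoc)
  note unfold_D = D_X[OF assms(3,4)] D_X[OF assms(5,6)] D_X[OF assms(3,6)] sg_def[symmetric]
  show ?thesis
  proof (cases "\<alpha> = \<beta>")
    case False
    then show ?thesis unfolding unfold_D using sg by (simp add: X_mult_disjoint)
  next
    case True
    then show ?thesis
      unfolding unfold_D X_mult Let_def sg X_zero[of "sg \<alpha> j", symmetric]
      using assms(3-6) sg(3)
      by (elim insertE emptyE) (simp_all add: a ba bb mult.assoc)
  qed
qed

lemma E_carrier: "i \<in> one_dim_index \<Longrightarrow> E i \<in> carrier_mat N N"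
  by (erule E_X_data) simp

lemma D_carrier: "j \<in> {1,2} \<Longrightarrow> k \<in> {1,2} \<Longrightarrow> D \<alpha> j k \<in> carrier_mat N N"
  by (rule D_eq_X) auto

definition components :: "complex mat set" where
  "components = E ` one_dim_index \<union> {D \<alpha> j k | \<alpha> j k. \<alpha> \<in> two_dim_index \<and> j \<in> {1,2} \<and> k \<in> {1,2}}"

lemma components_carrier: "components \<subseteq> carrier_mat N N"
  unfolding components_def using E_carrier D_carrier by blast

text \<open>Modulo \<open>m\<close>, every class is \<open>0\<close>, \<open>m/2\<close>, or \<open>\<plusminus>\<beta>\<close> for an index \<open>\<beta>\<close> of a two-dimensional component, and in each
  case the transition from \<open>F\<^sub>\<alpha>\<^sub>,\<^sub>0\<close>, \<open>F\<^sub>\<alpha>\<^sub>,\<^sub>1\<close> to the components is invertible.\<close>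
lemma X_in_span_components: "X \<alpha> p q \<in> adjacency_algebra N components"
proof -
  let ?V = "adjacency_algebra N components"
  note closed = adjacency_algebra_add[OF components_carrier] adjacency_algebra_smult[OF components_carrier]
  have E: "E i \<in> ?V" if "i \<in> one_dim_index" for i
    using that by (intro adjacency_algebra_base[OF components_carrier]) (auto simp: components_def)
  have D: "D \<beta> j k \<in> ?V" if "\<beta> \<in> two_dim_index" "j \<in> {1,2}" "k \<in> {1,2}" for \<beta> j k
    using that by (intro adjacency_algebra_base[OF components_carrier]) (auto simp: components_def)
  have zero: "X 0 p q \<in> ?V"
  proof -
    obtain a where a: "of_nat m * (of_nat n + 1) * a = 1"
      and E01: "E 0 = X 0 a a" "E 1 = X 0 (of_nat n * a) (- a)" by (rule E01_eq_X)
    have eq: "X 0 p q = (of_nat m * (p + of_nat n * q)) \<cdot>\<^sub>m E 0 + (of_nat m * (p - q)) \<cdot>\<^sub>m E 1"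
      unfolding E01 X_smult X_add
      by (intro arg_cong2[of _ _ _ _ "X 0"]; use a in Groebner_Basis.algebra)
    show ?thesis unfolding eq by (intro closed E) (auto simp: one_dim_index_def)
  qed
  have half: "X (int m div 2) p q \<in> ?V" if ev: "even m"
  proof -
    obtain a b where a: "2 * of_nat m * a = 1" and sb: "sqrt_n * b = a"
      and E23: "E 2 = X (int m div 2) a b" "E 3 = X (int m div 2) a (- b)" by (rule E23_eq_X)
    have eq: "X (int m div 2) p q =
        (of_nat m * (p + sqrt_n * q)) \<cdot>\<^sub>m E 2 + (of_nat m * (p - sqrt_n * q)) \<cdot>\<^sub>m E 3"
      unfolding E23 X_smult X_add
      by (intro arg_cong2[of _ _ _ _ "X _"]; use a sb in Groebner_Basis.algebra)
    show ?thesis unfolding eq using ev by (intro closed E) (auto simp: one_dim_index_def)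
  qed
  have two: "X \<beta> p q \<in> ?V" "X (-\<beta>) p q \<in> ?V" if \<beta>: "\<beta> \<in> two_dim_index" for \<beta>
  proof -
    obtain a b where a: "of_nat m * a = 1" and sb: "sqrt_n * b = a" and D_X':
      "\<forall>\<alpha>. \<forall>j\<in>{1,2}. \<forall>k\<in>{1,2}.
        D \<alpha> j k = X (if j = 1 then \<alpha> else - \<alpha>) (if j = k then a else 0) (if j = k then 0 else b)"
      by (rule D_eq_X)
    note D_X = D_X'[rule_format]
    have b: "of_nat m * sqrt_n * b = 1" using a sb by Groebner_Basis.algebra
    have ab: "of_nat m * p * a = p" "of_nat m * sqrt_n * q * b = q"
      using a b by Groebner_Basis.algebra+
    have eq: "X \<beta> p q = (of_nat m * p) \<cdot>\<^sub>m D \<beta> 1 1 + (of_nat m * sqrt_n * q) \<cdot>\<^sub>m D \<beta> 1 2"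
      "X (-\<beta>) p q = (of_nat m * p) \<cdot>\<^sub>m D \<beta> 2 2 + (of_nat m * sqrt_n * q) \<cdot>\<^sub>m D \<beta> 2 1"
      by (simp_all add: D_X X_smult X_add ab)
    show "X \<beta> p q \<in> ?V" "X (-\<beta>) p q \<in> ?V"
      unfolding eq using \<beta> by (auto intro!: closed D)
  qed
  define a where "a = \<alpha> mod int m"
  have a: "0 \<le> a" "a < int m" using m by (simp_all add: a_def)
  have Xa: "X \<alpha> p q = X a p q" by (rule X_cong) (simp add: a_def mod_eq_dvd_iff[symmetric])
  consider "a = 0" | "a \<in> two_dim_index" | "int m = 2 * a" | "int m - a \<in> two_dim_index"
    using a by (fastforce simp: two_dim_index_iff)
  then show ?thesis
  proof cases
    case 3
    then have "even (int m)" by simp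
    moreover have "int m div 2 = a" using 3 by simp
    ultimately show ?thesis using half Xa by simp
  next
    case 4
    have "X a p q = X (- (int m - a)) p q" by (rule X_cong) simp
    then show ?thesis using two(2)[OF 4] Xa by simp
  qed (use zero two Xa in auto)
qed

section \<open>The decomposition\<close>

text \<open>The multiplication rule gives the algebraic identities; \<open>E\<^sub>i \<noteq> 0\<close> and \<open>D\<^sub>1\<^sub>1\<^sup>\<alpha> \<noteq> 0\<close> are visible from the coefficient
  of \<open>F\<^sub>\<alpha>\<^sub>,\<^sub>0\<close>; the two spans agree by Fourier transform and inversion.\<close>
lemma wedderburn:
  "wedderburn_decomposition N (adjacency_algebra N {A l i | l i. l < m \<and> i \<in> {0,1}}) one_dim_index E two_dim_index D"
proof -
  obtain a b where a: "of_nat m * a = 1" and real: "cnj a = a" "cnj b = b" and D_X':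
    "\<forall>\<alpha>. \<forall>j\<in>{1,2}. \<forall>k\<in>{1,2}.
      D \<alpha> j k = X (if j = 1 then \<alpha> else - \<alpha>) (if j = k then a else 0) (if j = k then 0 else b)"
    by (rule D_eq_X)
  note D_X = D_X'[rule_format]
  have a_nz: "a \<noteq> 0" using a by auto
  show ?thesis
  proof (rule wedderburn_decompositionI, goal_cases)
    case 1 show ?case by (simp add: one_dim_index_def)
  next
    case 2 show ?case by (simp add: two_dim_index_def)
  next
    case 3 show ?case using A_carrier by auto
  next
    case (4 i) then show ?case by (rule E_carrier)
  next
    case (5 \<alpha> j k) from 5(2,3) show ?case by (rule D_carrier)
  next
    case (6 i) then show ?case by (rule E_X_data) (simp only: X_eq_zero_iff, simp)
  next
    case (7 \<alpha>) show ?case using a_nz by (simp add: D_X X_eq_zero_iff)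
  next
    case (8 i i') then show ?case by (rule E_mult)
  next
    case (9 i \<alpha> j k)
    obtain \<gamma> p q where E: "E i = X \<gamma> p q"
      and sep: "\<forall>\<beta>\<in>two_dim_index. \<not> int m dvd \<gamma> - \<beta> \<and> \<not> int m dvd \<gamma> + \<beta>"
      by (rule E_X_data[OF 9(1)])
    show ?case unfolding E D_X[OF 9(3,4)] using bspec[OF sep 9(2)]
      by (intro X_mult_disjoint) auto
  next
    case (10 i \<alpha> j k)
    obtain \<gamma> p q where E: "E i = X \<gamma> p q"
      and sep: "\<forall>\<beta>\<in>two_dim_index. \<not> int m dvd \<gamma> - \<beta> \<and> \<not> int m dvd \<gamma> + \<beta>"
      by (rule E_X_data[OF 10(1)])
    have "\<not> int m dvd \<alpha> - \<gamma>" "\<not> int m dvd \<alpha> + \<gamma>" "\<not> int m dvd - \<alpha> - \<gamma>" "\<not> int m dvd - \<alpha> + \<gamma>"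
      using bspec[OF sep 10(2)] dvd_minus_iff[of "int m" "\<gamma> + \<alpha>"]
      by (simp_all add: dvd_diff_commute add.commute)
    then show ?case unfolding E D_X[OF 10(3,4)] by (intro X_mult_disjoint) auto
  next
    case (11 \<alpha> \<beta> j k j' k') then show ?case by (rule D_mult)
  next
    case (12 i) then show ?case by (rule E_X_data) (simp add: X_adjoint)
  next
    case (13 \<alpha> j k) then show ?case
      by (auto simp: D_X X_adjoint X_adjoint_anti real)
  next
    case (14 i) then show ?case by (rule E_X_data) (simp only: X_in_span_A)
  next
    case (15 \<alpha> j k) then show ?case by (simp only: D_X X_in_span_A)
  next
    case 16
    have "A l i \<in> adjacency_algebra N components" if "i \<in> {0,1}" for l i
      unfolding A_fourier_inversion[OF that]
      by (rule finsum_mat_in_adjacency_algebra[OF _ _ components_carrier])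
         (auto intro!: adjacency_algebra_smult[OF components_carrier] X_in_span_components)
    then show ?case unfolding components_def by blast
  qed
qed

end

theorem theorem4p6:
  fixes n m :: nat and W :: "complex mat option mat"
  assumes "n > 0" and "m > 0"
    and "is_BGW (circ_group m) (n + 1) n (n - 1) W"
    and "\<forall>i<n + 1. \<forall>j<n + 1. W $$ (i,j) = W $$ (j,i)"
    and "\<forall>i<n + 1. W $$ (i,i) = None"
  shows
    "(even m \<longrightarrow>
        wedderburn_decomposition ((n + 1) * m)
          (adjacency_algebra ((n + 1) * m) {A_mat n m W l i | l i. l < m \<and> i \<in> {0,1}})
          {0,1,2,3} (E_one n m W)
          {1..int m div 2 - 1} (E_two n m W)) \<and>
     (odd m \<longrightarrow>
        wedderburn_decomposition ((n + 1) * m)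
          (adjacency_algebra ((n + 1) * m) {A_mat n m W l i | l i. l < m \<and> i \<in> {0,1}})
          {0,1} (E_one n m W)
          {1..(int m - 1) div 2} (E_two n m W))"
proof -
  interpret balanced_exponents n m "\<lambda>i j. int (entry_exponent m W i j)"
    by (rule BGW_balanced_exponents[OF assms])
  interpret bgw_scheme n m "\<lambda>i j. int (entry_exponent m W i j)" W
    by unfold_locales (use BGW_entry[OF assms(3,5)] in blast)
  show ?thesis
  proof (intro conjI impI)
    assume "even m"
    then have "one_dim_index = {0,1,2,3}" "two_dim_index = {1..int m div 2 - 1}"
      by (auto simp: one_dim_index_def two_dim_index_def elim!: evenE)
    from wedderburn[unfolded this N_def]
    show "wedderburn_decomposition ((n + 1) * m)
          (adjacency_algebra ((n + 1) * m) {A_mat n m W l i | l i. l < m \<and> i \<in> {0,1}})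
          {0,1,2,3} (E_one n m W) {1..int m div 2 - 1} (E_two n m W)" .
  next
    assume "odd m"
    then have "one_dim_index = {0,1}" "two_dim_index = {1..(int m - 1) div 2}"
      by (simp_all add: one_dim_index_def two_dim_index_def)
    from wedderburn[unfolded this N_def]
    show "wedderburn_decomposition ((n + 1) * m)
          (adjacency_algebra ((n + 1) * m) {A_mat n m W l i | l i. l < m \<and> i \<in> {0,1}})
          {0,1} (E_one n m W) {1..(int m - 1) div 2} (E_two n m W)" .
  qed
qed

end
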